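(* Let $\omega_c$ be a mesh cell subdivided into $N_k=\frac{(k+1)(k+2)}{2}$ subcells $S_1^c,\dots,S_{N_k}^c$, such that the projection matrix $P_c$ is invertible and the interior subgrid graph is connected. Then the discontinuous Galerkin scheme on $\omega_c$ in residual form, $$\frac{\mathrm{d}U_c}{\mathrm{d}t}=M_c^{-1}\,\Phi_c ,$$ can be recast as (i.e. is equivalent, through the correspondence $\overline{U}_c=P_c\,U_c$, to) the $N_k$ subcell finite-volume-like schemes $$\frac{\mathrm{d}\overline{U}_c}{\mathrm{d}t}=-D_c^{-1}\left(A_c\,\widehat{F_c}+B_c\right),$$ where the vector $\widehat{F_c}\in\mathbb{R}^{N_f^c}$ of finite volume fluxes (the reconstructed fluxes) is defined by $$\widehat{F_c}=-A_c^{\mathrm t}\,\mathcal{L}_c^{-1}\left(Q_c\,M_c^{-1}\,\Phi_c+B_c\right).$$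
   Context: **Continuous problem and DG scheme.** Consider the scalar conservation law $\partial_t u+\nabla_x\cdot\boldsymbol{F}(u)=0$ on $\omega\subset\mathbb{R}^2$ with flux function $\boldsymbol{F}:\mathbb{R}\to\mathbb{R}^2$. The domain is partitioned into non-overlapping polygonal cells $\{\omega_c\}_c$. Let $k\ge 0$, let $\mathbb{P}^k(\omega_c)$ be the space of polynomials in two variables of total degree at most $k$ on $\omega_c$, of dimension $N_k=\frac{(k+1)(k+2)}{2}$, and let $\{\sigma_m^c\}_{m=1}^{N_k}$ be a basis of it. The numerical solution on $\omega_c$ is $u_h^c(\boldsymbol{x},t)=\sum_{m=1}^{N_k}u_m^c(t)\,\sigma_m^c(\boldsymbol{x})$, and $U_c=(u_1^c,\dots,u_{N_k}^c)^{\mathrm t}$ is the vector of its moments. On $\partial\omega_c$ a numerical flux $\mathcal{F}_n=\mathcal{F}(u^-,u^+,\boldsymbol{n})$ is given, where $u^-$ and $u^+$ are the traces of the numerical solution from inside $\omega_c$ and from the neighbouring cell, and $\boldsymbol{n}$ is the unit outward normal to $\omega_c$. The mass matrix is $(M_c)_{mp}=\int_{\omega_c}\sigma_m^c\sigma_p^c\,\mathrm{d}V$ and the DG residual is $$(\Phi_c)_m=\int_{\omega_c}\boldsymbol{F}(u_h^c)\cdot\nabla_x\sigma_m^c\,\mathrm{d}V-\int_{\partial\omega_c}\sigma_m^c\,\mathcal{F}_n\,\mathrm{d}S .$$ **Subdivision.** The cell $\omega_c$ is partitioned into $N_k$ non-overlapping subcells $S_m^c$ of positive area $|S_m^c|$.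 The submean values of $u_h^c$ are $\overline{u}_m^c=\frac{1}{|S_m^c|}\int_{S_m^c}u_h^c\,\mathrm{d}V$, and $\overline{U}_c=(\overline{u}_1^c,\dots,\overline{u}_{N_k}^c)^{\mathrm t}$. The projection matrix is $(P_c)_{mp}=\frac{1}{|S_m^c|}\int_{S_m^c}\sigma_p^c\,\mathrm{d}V$, so that $\overline{U}_c=P_cU_c$. The subdivision is called admissible if $P_c$ is invertible. Further, $D_c=\mathrm{diag}(|S_1^c|,\dots,|S_{N_k}^c|)$, $Q_c=D_cP_c$, and $(B_c)_m=\int_{\partial S_m^c\cap\partial\omega_c}\mathcal{F}_n\,\mathrm{d}S$. **Interior faces and adjacency matrix.** Two subcells $S_m^c,S_p^c$ of $\omega_c$ are face neighbours if they share a face, denoted $f_{mp}^c$. Let $N_f^c$ be the number of subcell faces inside $\omega_c$ (not contained in $\partial\omega_c$). Each interior face is given a fixed, arbitrary orientation. Set $\varepsilon_{mp}^c=1$ if $f_{mp}^c$ is direct (seen from $S_m^c$) and $\varepsilon_{mp}^c=-1$ if it is indirect, so that $\varepsilon_{pm}^c=-\varepsilon_{mp}^c$. The adjacency matrix $A_c\in\mathbb{R}^{N_k\times N_f^c}$ has one row per subcell and one column per interior face: in the column of the face $f_{mp}^c$ the entry in row $m$ is $\varepsilon_{mp}^c$, the entry in row $p$ is $\varepsilon_{pm}^c=-\varepsilon_{mp}^c$, and all others are $0$. The interior subgrid graph has the subcells as vertices and the interior faces as edges. It is connected. **Inverse graph Laplacian.** $L_c=A_cA_c^{\mathrm t}$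 is the graph Laplacian, whose kernel is $\mathrm{span}\{\boldsymbol{1}\}$ with $\boldsymbol{1}=(1,\dots,1)^{\mathrm t}\in\mathbb{R}^{N_k}$. $\mathcal{L}_c^{-1}$ denotes the inverse of $L_c$ on the orthogonal of its kernel. For any $\lambda\ne0$ it is given by $\mathcal{L}_c^{-1}=(L_c+\lambda\Pi)^{-1}-\frac1\lambda\Pi$, with $\Pi=\frac{1}{N_k}\boldsymbol{1}\boldsymbol{1}^{\mathrm t}$. **Meaning of the fluxes.** The component of $\widehat{F_c}$ attached to the face $f_{mp}^c$, written $\widehat{F_{mp}}=\widehat{F_{pm}}$, is a face-integrated flux. The outgoing flux of $S_m^c$ through $f_{mp}^c$ is $\varepsilon_{mp}^c\widehat{F_{mp}}$. On $\partial\omega_c$ the flux is the DG numerical flux $\mathcal{F}_n$, which is accounted for by $B_c$. *)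

theory Defs
  imports
    "HOL-Analysis.Analysis"
    "Graph_Theory.Digraph_Component"
    "Jordan_Normal_Form.Gauss_Jordan_Elimination"
    "Jordan_Normal_Form.Matrix_Kernel"
begin

text \<open>
  Vectors and matrices are those of the AFP entry on Jordan normal forms: their dimensions are natural numbers, so
  that the number of interior faces may be 0 (it is for polynomial degree 0). Indices start at 0.
\<close>

hide_const (open) Finite_Cartesian_Product.vec Finite_Cartesian_Product.mat

type_synonym plane = "real \<times> real"

section \<open>Polygons and integrals over their boundary\<close>

text \<open>
  A polygon may be non-convex, and may have holes. The set \<open>E\<close> splits its boundary into edges, each
  given by its two end points (in an arbitrary order) and without overlap.
\<close>

definition polygon :: "plane set \<Rightarrow> (plane \<times> plane) set \<Rightarrow> bool" where
  "polygon S E \<longleftrightarrow>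
     compact S \<and> closure (interior S) = S \<and>
     finite E \<and> (\<forall>(a, b) \<in> E. a \<noteq> b) \<and>
     (\<forall>(a, b) \<in> E. \<forall>(a', b') \<in> E.
        (a, b) \<noteq> (a', b') \<longrightarrow> open_segment a b \<inter> open_segment a' b' = {}) \<and>
     frontier S = (\<Union>(a, b) \<in> E. closed_segment a b)"

definition edge_integral :: "(plane \<times> plane) set \<Rightarrow> (plane \<Rightarrow> real) \<Rightarrow> real" where
  "edge_integral E f =
     (\<Sum>(a, b) \<in> E. dist a b * (LINT s:{0..1}|lborel. f (linepath a b s)))"

definition edge_integrable :: "(plane \<times> plane) set \<Rightarrow> (plane \<Rightarrow> real) \<Rightarrow> bool" where
  "edge_integrable E f \<longleftrightarrow>
     (\<forall>(a, b) \<in> E. set_integrable lborel {0..1} (\<lambda>s. f (linepath a b s)))"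

text \<open>
  The unit outward normal exists at every boundary point where the set is locally a half plane,
  i.e. at all points of the boundary of a polygon but finitely many.
\<close>

definition outward_normal :: "plane set \<Rightarrow> plane \<Rightarrow> plane" where
  "outward_normal S x =
     (THE n. norm n = 1 \<and>
        (\<exists>r>0. S \<inter> ball x r = {y \<in> ball x r. inner (y - x) n \<le> 0}))"

section \<open>Polynomials\<close>

definition poly_space :: "nat \<Rightarrow> (plane \<Rightarrow> real) set" where
  "poly_space k =
     {p. \<exists>a :: nat \<Rightarrow> nat \<Rightarrow> real.
        p = (\<lambda>x. \<Sum>(i, j) \<in> {(i, j). i + j \<le> k}. a i j * fst x ^ i * snd x ^ j)}"

definition poly_basis :: "nat \<Rightarrow> nat \<Rightarrow> (nat \<Rightarrow> plane \<Rightarrow> real) \<Rightarrow> bool" where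
  "poly_basis k N \<sigma> \<longleftrightarrow>
     (\<forall>m<N. \<sigma> m \<in> poly_space k) \<and>
     (\<forall>p \<in> poly_space k. \<exists>!a. a \<in> carrier_vec N \<and> p = (\<lambda>x. \<Sum>m<N. a $ m * \<sigma> m x))"

definition grad :: "(plane \<Rightarrow> real) \<Rightarrow> plane \<Rightarrow> plane" where
  "grad f x = (THE D. GDERIV f x :> D)"

section \<open>Subdivided cells\<close>

text \<open>
  The arcs of the face graph are the interior faces. The orientation of an arc is that of the face:
  the face is direct seen from the tail subcell and indirect seen from the head subcell. If two
  subcells have several segments in common, these may be taken as one face or as several faces.
\<close>

record subdivided_cell =
  poly_degree :: nat
  cell_domain :: "plane set"
  edges :: "(plane \<times> plane) set"
  basis :: "nat \<Rightarrow> plane \<Rightarrow> real"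
  subcell :: "nat \<Rightarrow> plane set"
  face_graph :: "(nat, nat) pre_digraph"
  face :: "nat \<Rightarrow> plane set"

definition num_subcells :: "subdivided_cell \<Rightarrow> nat" where
  "num_subcells c = (poly_degree c + 1) * (poly_degree c + 2) div 2"

definition num_faces :: "subdivided_cell \<Rightarrow> nat" where
  "num_faces c = card (arcs (face_graph c))"

definition area :: "plane set \<Rightarrow> real" where
  "area S = measure lborel S"

definition subdivision :: "subdivided_cell \<Rightarrow> bool" where
  "subdivision c \<longleftrightarrow>
     (\<forall>m<num_subcells c. \<exists>E. polygon (subcell c m) E) \<and>
     (\<forall>m<num_subcells c. area (subcell c m) > 0) \<and>
     (\<Union>m<num_subcells c. subcell c m) = cell_domain c \<and>
     (\<forall>m<num_subcells c. \<forall>p<num_subcells c.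
        m \<noteq> p \<longrightarrow> interior (subcell c m) \<inter> interior (subcell c p) = {})"

definition interior_faces :: "subdivided_cell \<Rightarrow> bool" where
  "interior_faces c \<longleftrightarrow>
     (let G = face_graph c in
        loopfree_digraph G \<and> verts G = {..<num_subcells c} \<and> arcs G = {..<num_faces c} \<and>
        (\<forall>f \<in> arcs G.
           face c f \<subseteq> subcell c (tail G f) \<inter> subcell c (head G f) \<and>
           (\<exists>a b. a \<noteq> b \<and> closed_segment a b \<subseteq> face c f) \<and>
           \<not> face c f \<subseteq> frontier (cell_domain c)) \<and>
        (\<forall>f \<in> arcs G. \<forall>g \<in> arcs G. f \<noteq> g \<longrightarrow> finite (face c f \<inter> face c g)) \<and>
        (\<forall>m \<in> verts G. \<forall>p \<in> verts G. m \<noteq> p \<longrightarrow>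
           finite (subcell c m \<inter> subcell c p -
             (\<Union>f \<in> {f \<in> arcs G. {tail G f, head G f} = {m, p}}. face c f))))"

definition valid_cell :: "subdivided_cell \<Rightarrow> bool" where
  "valid_cell c \<longleftrightarrow>
     polygon (cell_domain c) (edges c) \<and>
     poly_basis (poly_degree c) (num_subcells c) (basis c) \<and>
     subdivision c \<and>
     interior_faces c"

section \<open>Matrices of a subdivided cell\<close>

definition matrix_inverse :: "real mat \<Rightarrow> real mat" where
  "matrix_inverse X = the (mat_inverse X)"

definition mass_matrix :: "subdivided_cell \<Rightarrow> real mat" where
  "mass_matrix c = mat (num_subcells c) (num_subcells c)
     (\<lambda>(m, p). LINT x:cell_domain c|lborel. basis c m x * basis c p x)"

definition projection_matrix :: "subdivided_cell \<Rightarrow> real mat" where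
  "projection_matrix c = mat (num_subcells c) (num_subcells c)
     (\<lambda>(m, p). 1 / area (subcell c m) * (LINT x:subcell c m|lborel. basis c p x))"

definition volume_matrix :: "subdivided_cell \<Rightarrow> real mat" where
  "volume_matrix c = mat_diag (num_subcells c) (\<lambda>m. area (subcell c m))"

definition adjacency_matrix :: "subdivided_cell \<Rightarrow> real mat" where
  "adjacency_matrix c = mat (num_subcells c) (num_faces c)
     (\<lambda>(m, f). if m = tail (face_graph c) f then 1
               else if m = head (face_graph c) f then - 1 else 0)"

definition laplacian_matrix :: "subdivided_cell \<Rightarrow> real mat" where
  "laplacian_matrix c = adjacency_matrix c * transpose_mat (adjacency_matrix c)"

text \<open>
  The inverse of a matrix on the orthogonal of its kernel is extended by 0 on the kernel. For the
  Laplacian of a connected graph with \<open>N\<close> vertices this is \<open>inverse (L + \<lambda> \<Pi>) - \<Pi> / \<lambda>\<close>,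
  where \<open>\<lambda> \<noteq> 0\<close> and all entries of \<open>\<Pi>\<close> are \<open>1 / N\<close>.
\<close>

definition kernel_orthogonal :: "real mat \<Rightarrow> real vec set" where
  "kernel_orthogonal L =
     {v \<in> carrier_vec (dim_col L). \<forall>w \<in> mat_kernel L. scalar_prod v w = 0}"

definition kernel_orthogonal_inverse :: "real mat \<Rightarrow> real mat" where
  "kernel_orthogonal_inverse L =
     (THE X. X \<in> carrier_mat (dim_col L) (dim_row L) \<and>
        (\<forall>v \<in> kernel_orthogonal L. X *\<^sub>v v \<in> kernel_orthogonal L \<and> L *\<^sub>v (X *\<^sub>v v) = v) \<and>
        (\<forall>v \<in> mat_kernel L. X *\<^sub>v v = 0\<^sub>v (dim_col L)))"

section \<open>Numerical solution, residual and fluxes\<close>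

text \<open>
  \<open>F\<close> is the flux function and \<open>H u\<^sup>- u\<^sup>+ n\<close> the numerical flux. The inner trace \<open>u\<^sup>-\<close> is that of the
  polynomial with moments \<open>U\<close>; \<open>w\<close> is the outer trace \<open>u\<^sup>+\<close>.
\<close>

definition dg_solution :: "subdivided_cell \<Rightarrow> real vec \<Rightarrow> plane \<Rightarrow> real" where
  "dg_solution c U x = (\<Sum>m<num_subcells c. U $ m * basis c m x)"

definition submeans :: "subdivided_cell \<Rightarrow> (plane \<Rightarrow> real) \<Rightarrow> real vec" where
  "submeans c u = vec (num_subcells c)
     (\<lambda>m. 1 / area (subcell c m) * (LINT x:subcell c m|lborel. u x))"

type_synonym numerical_flux = "real \<Rightarrow> real \<Rightarrow> plane \<Rightarrow> real"

definition normal_flux ::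
  "subdivided_cell \<Rightarrow> numerical_flux \<Rightarrow> (plane \<Rightarrow> real) \<Rightarrow> real vec \<Rightarrow> plane \<Rightarrow> real" where
  "normal_flux c H w U x = H (dg_solution c U x) (w x) (outward_normal (cell_domain c) x)"

definition residual_defined ::
  "subdivided_cell \<Rightarrow> (real \<Rightarrow> plane) \<Rightarrow> numerical_flux \<Rightarrow> (plane \<Rightarrow> real) \<Rightarrow> real vec \<Rightarrow> bool" where
  "residual_defined c F H w U \<longleftrightarrow>
     (\<forall>m<num_subcells c.
        set_integrable lborel (cell_domain c)
          (\<lambda>x. inner (F (dg_solution c U x)) (grad (basis c m) x)) \<and>
        edge_integrable (edges c) (\<lambda>x. basis c m x * normal_flux c H w U x))"

definition residual ::
  "subdivided_cell \<Rightarrow> (real \<Rightarrow> plane) \<Rightarrow> numerical_flux \<Rightarrow> (plane \<Rightarrow> real) \<Rightarrow> real vec \<Rightarrow> real vec" where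
  "residual c F H w U = vec (num_subcells c)
     (\<lambda>m. (LINT x:cell_domain c|lborel. inner (F (dg_solution c U x)) (grad (basis c m) x))
          - edge_integral (edges c) (\<lambda>x. basis c m x * normal_flux c H w U x))"

definition boundary_flux ::
  "subdivided_cell \<Rightarrow> numerical_flux \<Rightarrow> (plane \<Rightarrow> real) \<Rightarrow> real vec \<Rightarrow> real vec" where
  "boundary_flux c H w U = vec (num_subcells c)
     (\<lambda>m. edge_integral (edges c)
        (\<lambda>x. indicator (frontier (subcell c m) \<inter> frontier (cell_domain c)) x * normal_flux c H w U x))"

definition reconstructed_flux ::
  "subdivided_cell \<Rightarrow> (real \<Rightarrow> plane) \<Rightarrow> numerical_flux \<Rightarrow> (plane \<Rightarrow> real) \<Rightarrow> real vec \<Rightarrow> real vec" where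
  "reconstructed_flux c F H w U =
     (let A = adjacency_matrix c; Linv = kernel_orthogonal_inverse (laplacian_matrix c);
          Q = volume_matrix c * projection_matrix c
      in - (transpose_mat A *\<^sub>v (Linv *\<^sub>v
            (Q *\<^sub>v (matrix_inverse (mass_matrix c) *\<^sub>v residual c F H w U)
             + boundary_flux c H w U))))"

definition has_time_derivative :: "(real \<Rightarrow> real vec) \<Rightarrow> real vec \<Rightarrow> real filter \<Rightarrow> bool" where
  "has_time_derivative X V Net \<longleftrightarrow>
     (\<forall>m<dim_vec V. ((\<lambda>s. X s $ m) has_real_derivative V $ m) Net)"

end

theory Submission
  imports Defs
begin

text \<open>
  Let \<open>r = Q M\<^sup>-\<^sup>1 \<Phi> + B\<close>. On both sides of the equivalence the submeans are \<open>P U\<close> with one constant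
  invertible \<open>P\<close>, so the residual form is the same as \<open>d(P U)/dt = P M\<^sup>-\<^sup>1 \<Phi> = D\<^sup>-\<^sup>1 (r - B)\<close>. The subcell
  scheme has this right-hand side as soon as its fluxes satisfy \<open>A F = - r\<close>
  (\<open>reconstructed_flux_divergence\<close>). The reconstructed fluxes give \<open>A F = - L \<L>\<^sup>-\<^sup>1 r\<close>, and this is \<open>- r\<close>
  if \<open>r\<close> is orthogonal to the kernel of \<open>L\<close>. For a connected graph the kernel consists of the
  constants, so all that remains is that the entries of \<open>r\<close> sum to 0 (\<open>flux_balance\<close>).

  That is conservation, obtained by testing the scheme with the constant 1. Let \<open>a\<close> be the moments
  of the constant 1 and \<open>v\<close> the polynomial with moments \<open>M\<^sup>-\<^sup>1 \<Phi>\<close>. The entries of \<open>Q M\<^sup>-\<^sup>1 \<Phi>\<close> are the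
  integrals of \<open>v\<close> over the subcells, so they sum to the integral of \<open>1 v\<close> over the cell, which
  is \<open>a \<bullet> M M\<^sup>-\<^sup>1 \<Phi> = a \<bullet> \<Phi>\<close>. The gradient of 1 vanishes, so only the boundary term of the residual
  survives: \<open>a \<bullet> \<Phi>\<close> is minus the integral of the numerical flux over the boundary of the cell.
  The sum of the entries of \<open>B\<close> is that same integral.

  Two facts about polygons are behind these sums: distinct subcells overlap in a null set, and all
  but finitely many points of the boundary of the cell belong to exactly one subcell. The second one
  holds because, apart from finitely many points, two subcells that meet occupy the two sides of a
  common line, and then their union is a neighbourhood of the point
  (\<open>polygons_meet_outside_interior_finite\<close>). The mass matrix is invertible since a
  polynomial whose square has integral 0 over the cell vanishes on an open set, hence everywhere.
\<close>

(* leaves the dollar sign to the entries of vectors with numeric dimension *)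
unbundle no vec_syntax

section \<open>Invertible matrices\<close>

lemma matrix_inverse_injective:
  assumes X: "X \<in> carrier_mat n n"
    and inj: "\<And>v. v \<in> carrier_vec n \<Longrightarrow> X *\<^sub>v v = 0\<^sub>v n \<Longrightarrow> v = 0\<^sub>v n"
  shows "matrix_inverse X \<in> carrier_mat n n"
    and "X * matrix_inverse X = 1\<^sub>m n"
    and "matrix_inverse X * X = 1\<^sub>m n"
proof -
  have "det X \<noteq> 0"
    using inj det_0_iff_vec_prod_zero_field[OF X] by blast
  hence "X \<in> Units (ring_mat TYPE(real) n (undefined :: unit))"
    by (rule det_non_zero_imp_unit[OF X])
  then obtain Y where Y: "mat_inverse X = Some Y"
    using mat_inverse(1)[OF X, where b = "undefined :: unit"] by (cases "mat_inverse X") auto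
  show "matrix_inverse X \<in> carrier_mat n n"
    and "X * matrix_inverse X = 1\<^sub>m n"
    and "matrix_inverse X * X = 1\<^sub>m n"
    using mat_inverse(2)[OF X Y] Y by (auto simp: matrix_inverse_def)
qed

lemma mat_eqI_mult_vec:
  fixes X Y :: "'a :: comm_semiring_1 mat"
  assumes X: "X \<in> carrier_mat m n" and Y: "Y \<in> carrier_mat m n"
    and eq: "\<And>v. v \<in> carrier_vec n \<Longrightarrow> X *\<^sub>v v = Y *\<^sub>v v"
  shows "X = Y"
proof (rule eq_matI)
  fix i j assume "i < dim_row Y" "j < dim_col Y"
  hence i: "i < m" and j: "j < n" using Y by auto
  have entry: "(Z *\<^sub>v unit_vec n j) $ i = Z $$ (i, j)" if "Z \<in> carrier_mat m n" for Z :: "'a mat"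
    using that i j scalar_prod_right_unit[of j n "row Z i"] by auto
  show "X $$ (i, j) = Y $$ (i, j)"
    using entry[OF X] entry[OF Y] eq[of "unit_vec n j"] by simp
qed (use X Y in auto)

section \<open>The Laplacian of a connected graph\<close>

definition averaging_matrix :: "nat \<Rightarrow> real mat" where
  "averaging_matrix n = mat n n (\<lambda>_. 1 / real n)"

lemma averaging_matrix_dim [simp]: "averaging_matrix n \<in> carrier_mat n n"
  by (simp add: averaging_matrix_def)

lemma averaging_matrix_mult:
  assumes "v \<in> carrier_vec n"
  shows "averaging_matrix n *\<^sub>v v = vec n (\<lambda>_. (\<Sum>i<n. v $ i) / real n)"
  using assms
  by (intro eq_vecI)
     (auto simp: averaging_matrix_def scalar_prod_def sum_divide_distrib lessThan_atLeast0)

text \<open>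
  The hypotheses \<open>ker\<close> and \<open>ran\<close> describe the Laplacian of a connected graph. With \<open>\<Pi>\<close> the averaging
  matrix, \<open>L + \<Pi>\<close> is injective: it preserves the sum of the entries, so a vector that it kills has
  sum 0, is therefore killed by \<open>L\<close>, and is a constant with sum 0. The witness for the inverse on the
  orthogonal of the kernel is \<open>(L + \<Pi>)\<^sup>-\<^sup>1 - \<Pi>\<close>.
\<close>

lemma kernel_orthogonal_inverse_solves:
  fixes L :: "real mat"
  assumes n: "n > 0" and L: "L \<in> carrier_mat n n"
    and ker: "\<And>v. v \<in> carrier_vec n \<Longrightarrow> L *\<^sub>v v = 0\<^sub>v n \<longleftrightarrow> (\<exists>a. v = vec n (\<lambda>_. a))"
    and ran: "\<And>v. v \<in> carrier_vec n \<Longrightarrow> (\<Sum>i<n. (L *\<^sub>v v) $ i) = 0"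
  shows "kernel_orthogonal_inverse L \<in> carrier_mat n n"
    and "\<And>v. v \<in> carrier_vec n \<Longrightarrow> (\<Sum>i<n. v $ i) = 0 \<Longrightarrow>
           L *\<^sub>v (kernel_orthogonal_inverse L *\<^sub>v v) = v"
proof -
  let ?\<Pi> = "averaging_matrix n"
  define G where "G = L + ?\<Pi>"
  define Y where "Y = matrix_inverse G"
  define Z where "Z = Y - ?\<Pi>"
  have dims: "dim_col L = n" "dim_row L = n" using L by auto
  have G: "G \<in> carrier_mat n n" using L by (simp add: G_def)
  have Lv: "L *\<^sub>v v \<in> carrier_vec n" if "v \<in> carrier_vec n" for v
    using L that by simp
  have Gv: "G *\<^sub>v v = L *\<^sub>v v + vec n (\<lambda>_. (\<Sum>i<n. v $ i) / real n)" if "v \<in> carrier_vec n" for v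
    using that L by (simp add: G_def add_mult_distrib_mat_vec[of _ n n] averaging_matrix_mult)
  have sumG: "(\<Sum>i<n. (G *\<^sub>v v) $ i) = (\<Sum>i<n. v $ i)" if v: "v \<in> carrier_vec n" for v
    using n Lv[OF v] ran[OF v] by (simp add: Gv[OF v] sum.distrib)
  have inj: "v = 0\<^sub>v n" if v: "v \<in> carrier_vec n" and 0: "G *\<^sub>v v = 0\<^sub>v n" for v
  proof -
    have s: "(\<Sum>i<n. v $ i) = 0" using sumG[OF v] 0 by simp
    hence "L *\<^sub>v v = 0\<^sub>v n"
      using 0 Lv[OF v] by (simp add: Gv[OF v] zero_vec_def[symmetric])
    then obtain a where a: "v = vec n (\<lambda>_. a)" using ker[OF v] by blast
    have "a = 0" using s n by (simp add: a)
    thus ?thesis by (simp add: a zero_vec_def)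
  qed
  note inv = matrix_inverse_injective[OF G inj, folded Y_def]
  have Y: "Y \<in> carrier_mat n n" by (rule inv(1))
  have Z: "Z \<in> carrier_mat n n" using Y by (simp add: Z_def minus_carrier_mat)
  have YG: "Y *\<^sub>v (G *\<^sub>v v) = v" if "v \<in> carrier_vec n" for v
    using inv(3) that by (metis G Y assoc_mult_mat_vec one_mult_mat_vec)
  have GY: "G *\<^sub>v (Y *\<^sub>v v) = v" if "v \<in> carrier_vec n" for v
    using inv(2) that by (metis G Y assoc_mult_mat_vec one_mult_mat_vec)
  have Zv: "Z *\<^sub>v v = Y *\<^sub>v v - vec n (\<lambda>_. (\<Sum>i<n. v $ i) / real n)" if "v \<in> carrier_vec n" for v
    using that Y by (simp add: Z_def minus_mult_distrib_mat_vec[of _ n n] averaging_matrix_mult)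
  have kerL: "mat_kernel L = {vec n (\<lambda>_. a) | a. True}"
    using ker by (auto simp: mat_kernel[OF L])
  have ortho: "kernel_orthogonal L = {v \<in> carrier_vec n. (\<Sum>i<n. v $ i) = 0}"
  proof -
    have *: "scalar_prod v (vec n (\<lambda>_. a)) = a * (\<Sum>i<n. v $ i)" for v :: "real vec" and a
      by (simp add: scalar_prod_def lessThan_atLeast0 sum_distrib_left mult.commute)
    have "(\<forall>a. a * (\<Sum>i<n. v $ i) = 0) \<longleftrightarrow> (\<Sum>i<n. v $ i) = 0" for v :: "real vec"
      by (metis mult_1 mult_zero_right)
    thus ?thesis unfolding kernel_orthogonal_def kerL dims
      by (auto simp: *)
  qed
  let ?P = "\<lambda>X. X \<in> carrier_mat (dim_col L) (dim_row L) \<and>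
        (\<forall>v \<in> kernel_orthogonal L. X *\<^sub>v v \<in> kernel_orthogonal L \<and> L *\<^sub>v (X *\<^sub>v v) = v) \<and>
        (\<forall>v \<in> mat_kernel L. X *\<^sub>v v = 0\<^sub>v (dim_col L))"
  have PZ: "?P Z"
  proof (intro conjI ballI)
    show "Z \<in> carrier_mat (dim_col L) (dim_row L)" using Z by (simp add: dims)
  next
    fix v assume "v \<in> kernel_orthogonal L"
    hence v: "v \<in> carrier_vec n" and s: "(\<Sum>i<n. v $ i) = 0" by (auto simp: ortho)
    have Yv: "Y *\<^sub>v v \<in> carrier_vec n" using Y v by simp
    have ZY: "Z *\<^sub>v v = Y *\<^sub>v v"
      using Yv s by (simp add: Zv[OF v] zero_vec_def[symmetric])
    have s': "(\<Sum>i<n. (Y *\<^sub>v v) $ i) = 0" using sumG[OF Yv] GY[OF v] s by simp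
    thus "Z *\<^sub>v v \<in> kernel_orthogonal L" using Yv by (simp add: ZY ortho)
    show "L *\<^sub>v (Z *\<^sub>v v) = v"
      using GY[OF v] Lv[OF Yv] s' by (simp add: ZY Gv[OF Yv] zero_vec_def[symmetric])
  next
    fix v assume "v \<in> mat_kernel L"
    then obtain a where a: "v = vec n (\<lambda>_. a)" by (auto simp: kerL)
    have v: "v \<in> carrier_vec n" by (simp add: a)
    have avg: "vec n (\<lambda>_. (\<Sum>i<n. v $ i) / real n) = v" using n by (simp add: a)
    have "L *\<^sub>v v = 0\<^sub>v n" using ker[OF v] a by blast
    hence "G *\<^sub>v v = v" using Gv[OF v] avg v by simp
    hence "Y *\<^sub>v v = v" using YG[OF v] by simp
    thus "Z *\<^sub>v v = 0\<^sub>v (dim_col L)" using v by (simp add: Zv[OF v] avg dims)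
  qed
  have unique: "X = Z" if PX: "?P X" for X
  proof -
    have X: "X \<in> carrier_mat n n" using PX by (simp add: dims)
    have "X *\<^sub>v v = Z *\<^sub>v v" if v: "v \<in> carrier_vec n" for v
    proof -
      (* a vector is the sum of its mean, which is in the kernel, and an orthogonal rest *)
      define k where "k = vec n (\<lambda>_. (\<Sum>i<n. v $ i) / real n)"
      define q where "q = v - k"
      have k: "k \<in> carrier_vec n" and q: "q \<in> carrier_vec n" using v by (auto simp: k_def q_def)
      have kk: "k \<in> mat_kernel L" by (auto simp: kerL k_def)
      have "(\<Sum>i<n. q $ i) = 0"
        using v n by (simp add: q_def k_def sum_subtractf)
      hence qq: "q \<in> kernel_orthogonal L" using q by (simp add: ortho)
      have dec: "v = q + k" using v by (auto simp: q_def k_def)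
      define d where "d = X *\<^sub>v q - Z *\<^sub>v q"
      have Xq: "X *\<^sub>v q \<in> carrier_vec n" and Zq: "Z *\<^sub>v q \<in> carrier_vec n" using X Z q by auto
      have d: "d \<in> carrier_vec n" using Xq Zq by (simp add: d_def)
      have sX: "(\<Sum>i<n. (X *\<^sub>v q) $ i) = 0" and sZ: "(\<Sum>i<n. (Z *\<^sub>v q) $ i) = 0"
        using PX PZ qq by (auto simp: ortho)
      have sd: "(\<Sum>i<n. d $ i) = 0"
        using sX sZ Xq Zq X Z by (simp add: d_def sum_subtractf)
      have "L *\<^sub>v d = L *\<^sub>v (X *\<^sub>v q) - L *\<^sub>v (Z *\<^sub>v q)"
        unfolding d_def by (rule mult_minus_distrib_mat_vec[OF L Xq Zq])
      also have "\<dots> = 0\<^sub>v n" using PX PZ qq q by simp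
      finally obtain a where a: "d = vec n (\<lambda>_. a)" using ker[OF d] by blast
      have "a = 0" using sd n by (simp add: a)
      hence d0: "d = 0\<^sub>v n" by (simp add: a zero_vec_def)
      have eq: "X *\<^sub>v q = Z *\<^sub>v q"
      proof (rule eq_vecI)
        fix i assume "i < dim_vec (Z *\<^sub>v q)"
        hence "i < n" using Z by simp
        moreover have "d $ i = (X *\<^sub>v q) $ i - (Z *\<^sub>v q) $ i"
          using \<open>i < n\<close> Zq Z by (simp add: d_def)
        ultimately show "(X *\<^sub>v q) $ i = (Z *\<^sub>v q) $ i" by (simp add: d0)
      qed (use X Z in auto)
      have "X *\<^sub>v k = Z *\<^sub>v k" using PX PZ kk by simp
      thus ?thesis using eq
        by (simp add: dec mult_add_distrib_mat_vec[OF X q k] mult_add_distrib_mat_vec[OF Z q k])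
    qed
    thus ?thesis by (rule mat_eqI_mult_vec[OF X Z])
  qed
  have "kernel_orthogonal_inverse L = Z"
    unfolding kernel_orthogonal_inverse_def
    by (rule the_equality[where P = ?P, OF PZ unique])
  with Z PZ show "kernel_orthogonal_inverse L \<in> carrier_mat n n"
    and "\<And>v. v \<in> carrier_vec n \<Longrightarrow> (\<Sum>i<n. v $ i) = 0 \<Longrightarrow>
           L *\<^sub>v (kernel_orthogonal_inverse L *\<^sub>v v) = v"
    by (auto simp: ortho)
qed

lemma connected_constant:
  fixes G :: "('a, 'b) pre_digraph" and x :: "'a \<Rightarrow> 'c"
  assumes con: "Digraph_Component.connected G"
    and arc: "\<And>f. f \<in> arcs G \<Longrightarrow> x (tail G f) = x (head G f)"
    and u: "u \<in> verts G" and v: "v \<in> verts G"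
  shows "x u = x v"
proof -
  have "(u, v) \<in> rtrancl_on (verts (mk_symmetric G)) (arcs_ends (mk_symmetric G))"
    using con u v by (auto simp: Digraph_Component.connected_def strongly_connected_def reachable_def)
  thus ?thesis
  proof (induction rule: rtrancl_on_induct)
    case (step y z)
    have "x y = x z" using \<open>(y, z) \<in> arcs_ends _\<close> arc by (auto simp: parcs_mk_symmetric)
    with step show ?case by simp
  qed simp
qed

lemma adjacency_matrix_dim [simp]:
  "adjacency_matrix c \<in> carrier_mat (num_subcells c) (num_faces c)"
  "dim_row (adjacency_matrix c) = num_subcells c" "dim_col (adjacency_matrix c) = num_faces c"
  by (simp_all add: adjacency_matrix_def)

text \<open>
  The transpose of the adjacency matrix is the discrete gradient: it maps subcell values to their
  jumps over the faces. Both facts on the Laplacian below come from this formula.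
\<close>

lemma adjacency_transpose_index:
  assumes c: "interior_faces c" and f: "f < num_faces c" and v: "v \<in> carrier_vec (num_subcells c)"
  shows "(transpose_mat (adjacency_matrix c) *\<^sub>v v) $ f =
    v $ tail (face_graph c) f - v $ head (face_graph c) f"
proof -
  let ?G = "face_graph c"
  interpret loopfree_digraph ?G using c by (simp add: interior_faces_def Let_def)
  have fa: "f \<in> arcs ?G" and vs: "verts ?G = {..<num_subcells c}"
    using c f by (auto simp: interior_faces_def Let_def)
  have th: "tail ?G f < num_subcells c" "head ?G f < num_subcells c" "tail ?G f \<noteq> head ?G f"
    using tail_in_verts[OF fa] head_in_verts[OF fa] no_loops[OF fa] vs by auto
  have "(transpose_mat (adjacency_matrix c) *\<^sub>v v) $ f =
      (\<Sum>m<num_subcells c. adjacency_matrix c $$ (m, f) * v $ m)"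
    using f v by (simp add: scalar_prod_def adjacency_matrix_def lessThan_atLeast0)
  also have "\<dots> = (\<Sum>m<num_subcells c.
      (if m = tail ?G f then v $ m else 0) - (if m = head ?G f then v $ m else 0))"
    using f th by (intro sum.cong) (auto simp: adjacency_matrix_def)
  also have "\<dots> = v $ tail ?G f - v $ head ?G f"
    using th by (simp add: sum_subtractf)
  finally show ?thesis .
qed

lemma laplacian_matrix_dim [simp]:
  "laplacian_matrix c \<in> carrier_mat (num_subcells c) (num_subcells c)"
  unfolding laplacian_matrix_def
  by (rule mult_carrier_mat[OF adjacency_matrix_dim(1)]) simp

lemma laplacian_matrix_kernel:
  assumes c: "interior_faces c" and con: "Digraph_Component.connected (face_graph c)"
    and v: "v \<in> carrier_vec (num_subcells c)"
  shows "laplacian_matrix c *\<^sub>v v = 0\<^sub>v (num_subcells c) \<longleftrightarrow> (\<exists>a. v = vec (num_subcells c) (\<lambda>_. a))"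
proof
  let ?A = "adjacency_matrix c" and ?N = "num_subcells c" and ?n = "num_faces c" and ?G = "face_graph c"
  let ?g = "transpose_mat ?A *\<^sub>v v"
  have A: "?A \<in> carrier_mat ?N ?n" by simp
  have At: "transpose_mat ?A \<in> carrier_mat ?n ?N" using A by simp
  have g: "?g \<in> carrier_vec ?n" by (rule mult_mat_vec_carrier[OF At v])
  have L: "laplacian_matrix c *\<^sub>v v = ?A *\<^sub>v ?g"
    unfolding laplacian_matrix_def by (rule assoc_mult_mat_vec[OF A At v])
  have vs: "verts ?G = {..<?N}" and as: "arcs ?G = {..<?n}"
    and lf: "loopfree_digraph ?G"
    using c by (auto simp: interior_faces_def Let_def)
  {
    assume "laplacian_matrix c *\<^sub>v v = 0\<^sub>v ?N"
    hence "scalar_prod (?A *\<^sub>v ?g) v = 0" using v by (simp add: L)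
    \<comment> \<open>the quadratic form of the Laplacian is the sum of the squares of the jumps over the faces\<close>
    hence "scalar_prod ?g ?g = 0"
      using transpose_vec_mult_scalar[OF A g v] A g v
      by (metis comm_scalar_prod mult_mat_vec_carrier)
    hence "\<forall>f<?n. ?g $ f = 0"
      using sum_nonneg_eq_0_iff[of "{0..<?n}" "\<lambda>f. ?g $ f * ?g $ f"] carrier_vecD[OF g]
      by (auto simp: scalar_prod_def simp del: index_mult_mat_vec)
    hence "\<And>f. f \<in> arcs ?G \<Longrightarrow> v $ tail ?G f = v $ head ?G f"
      using adjacency_transpose_index[OF c _ v] as by simp
    hence const: "v $ i = v $ j" if "i < ?N" "j < ?N" for i j
      using connected_constant[OF con, of "\<lambda>i. v $ i" i j] that vs by simp
    have "v = vec ?N (\<lambda>_. v $ 0)"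
    proof (rule eq_vecI)
      fix i assume "i < dim_vec (vec ?N (\<lambda>_. v $ 0))"
      thus "v $ i = vec ?N (\<lambda>_. v $ 0) $ i" using const[of i 0] by simp
    qed (use v in simp)
    thus "\<exists>a. v = vec ?N (\<lambda>_. a)" ..
  next
    assume "\<exists>a. v = vec ?N (\<lambda>_. a)"
    then obtain a where a: "v = vec ?N (\<lambda>_. a)" ..
    interpret loopfree_digraph ?G by (rule lf)
    have "?g $ f = 0" if f: "f < ?n" for f
      using adjacency_transpose_index[OF c f v] tail_in_verts[of f] head_in_verts[of f] f vs as
      by (simp add: a)
    hence "?g = 0\<^sub>v ?n" using carrier_vecD[OF g]
      by (intro eq_vecI) (auto simp del: index_mult_mat_vec dim_mult_mat_vec)
    thus "laplacian_matrix c *\<^sub>v v = 0\<^sub>v ?N"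
      using A by (intro eq_vecI) (auto simp: L)
  }
qed

text \<open>
  The sum of the entries of \<open>A g\<close> is the scalar product of \<open>g\<close> with the jumps of the constant 1.
\<close>

lemma laplacian_matrix_range:
  assumes c: "interior_faces c" and v: "v \<in> carrier_vec (num_subcells c)"
  shows "(\<Sum>i<num_subcells c. (laplacian_matrix c *\<^sub>v v) $ i) = 0"
proof -
  let ?A = "adjacency_matrix c" and ?N = "num_subcells c" and ?n = "num_faces c" and ?G = "face_graph c"
  let ?one = "vec ?N (\<lambda>_. 1)"
  let ?g = "transpose_mat ?A *\<^sub>v v"
  have A: "?A \<in> carrier_mat ?N ?n" by simp
  have At: "transpose_mat ?A \<in> carrier_mat ?n ?N" using A by simp
  have g: "?g \<in> carrier_vec ?n" by (rule mult_mat_vec_carrier[OF At v])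
  have vs: "verts ?G = {..<?N}" and as: "arcs ?G = {..<?n}" 
    using c by (auto simp: interior_faces_def Let_def)
  interpret loopfree_digraph ?G using c by (simp add: interior_faces_def Let_def)
  have one: "?one \<in> carrier_vec ?N" by simp
  have "(transpose_mat ?A *\<^sub>v ?one) $ f = 0" if f: "f < ?n" for f
    using adjacency_transpose_index[OF c f one] tail_in_verts[of f] head_in_verts[of f] f vs as
    by simp
  hence z: "transpose_mat ?A *\<^sub>v ?one = 0\<^sub>v ?n"
    using carrier_matD[OF At] by (intro eq_vecI) (auto simp del: index_mult_mat_vec)
  have "(\<Sum>i<?N. (laplacian_matrix c *\<^sub>v v) $ i) = scalar_prod (?A *\<^sub>v ?g) ?one"
    unfolding laplacian_matrix_def assoc_mult_mat_vec[OF A At v]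
    by (simp add: scalar_prod_def lessThan_atLeast0)
  also have "\<dots> = scalar_prod (transpose_mat ?A *\<^sub>v ?one) ?g"
    using transpose_vec_mult_scalar[OF A g one] A g
    by (metis comm_scalar_prod mult_mat_vec_carrier one)
  also have "\<dots> = 0" using g by (simp add: z)
  finally show ?thesis .
qed

section \<open>Polygons with disjoint interiors\<close>

text \<open>
  Along the segment the linear form is affine in the parameter, so it takes the value \<open>c\<close>
  everywhere, once, or never.
\<close>

lemma finite_segment_Int_hyperplane:
  fixes a b n :: "'a::euclidean_space"
  assumes "\<not> closed_segment a b \<subseteq> {x. inner n x = c}"
  shows "finite (closed_segment a b \<inter> {x. inner n x = c})"
proof -
  have at: "inner n (linepath a b s) = inner n a + s * inner n (b - a)" for s
    by (simp add: linepath_def inner_simps algebra_simps)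
  show ?thesis
  proof (cases "inner n (b - a) = 0")
    case True
    have "inner n x = inner n a" if "x \<in> closed_segment a b" for x
    proof -
      from that obtain s where "x = linepath a b s" by (auto simp: linepath_image_01[symmetric])
      thus ?thesis using at[of s] True by simp
    qed
    hence "closed_segment a b \<inter> {x. inner n x = c} = {}"
      using assms by (metis (mono_tags, lifting) Int_emptyI mem_Collect_eq subsetI)
    thus ?thesis by simp
  next
    case False
    have "closed_segment a b \<inter> {x. inner n x = c} \<subseteq> {linepath a b ((c - inner n a) / inner n (b - a))}"
    proof
      fix x assume x: "x \<in> closed_segment a b \<inter> {x. inner n x = c}"
      then obtain s where s: "x = linepath a b s" by (auto simp: linepath_image_01[symmetric])
      have "s * inner n (b - a) = c - inner n a" using x at[of s] s by simp
      hence "s = (c - inner n a) / inner n (b - a)" using False by (simp add: field_simps)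
      thus "x \<in> {linepath a b ((c - inner n a) / inner n (b - a))}" using s by simp
    qed
    thus ?thesis by (rule finite_subset) simp
  qed
qed

lemma segment_in_line:
  fixes a b :: plane
  assumes "a \<noteq> b"
  obtains n c where "n \<noteq> 0" "closed_segment a b \<subseteq> {x. inner n x = c}"
proof
  let ?n = "(snd b - snd a, fst a - fst b) :: plane"
  show "?n \<noteq> 0" using assms by (auto simp: zero_prod_def prod_eq_iff)
  have "inner ?n (linepath a b s) = inner ?n a" for s
    by (simp add: linepath_def inner_prod_def algebra_simps)
  thus "closed_segment a b \<subseteq> {x. inner ?n x = inner ?n a}"
    by (auto simp: linepath_image_01[symmetric])
qed

lemma negligible_polygon_frontier:
  assumes "polygon S E"
  shows "negligible (frontier S)"
proof -
  have "negligible (closed_segment (fst e) (snd e))" if "e \<in> E" for e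
  proof -
    have "fst e \<noteq> snd e" using assms that by (auto simp: polygon_def)
    then obtain n c where n: "n \<noteq> 0" "closed_segment (fst e) (snd e) \<subseteq> {x. inner n x = c}"
      by (rule segment_in_line)
    show ?thesis by (rule negligible_subset[OF negligible_hyperplane n(2)]) (use n in simp)
  qed
  moreover have "frontier S = (\<Union>e\<in>E. closed_segment (fst e) (snd e))" and "finite E"
    using assms by (auto simp: polygon_def case_prod_unfold)
  ultimately show ?thesis by (metis (mono_tags, lifting) negligible_Union finite_imageI imageE)
qed

text \<open>
  The finitely many exceptional points are those where the line through one segment is crossed by a
  segment that it does not contain. At any other point \<open>x\<close> of a segment, all segments through \<open>x\<close>
  lie in the line through that segment, and the others stay at a positive distance from \<open>x\<close>.
\<close>

lemma segments_locally_in_line: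
  fixes E :: "(plane \<times> plane) set"
  defines "K \<equiv> \<Union>(a, b) \<in> E. closed_segment a b"
  assumes fin: "finite E" and ne: "\<forall>(a, b) \<in> E. a \<noteq> b"
  obtains B where "finite B"
    and "\<And>x. x \<in> K - B \<Longrightarrow> \<exists>r>0. \<exists>n. n \<noteq> 0 \<and> K \<inter> ball x r \<subseteq> {y. inner n (y - x) = 0}"
proof -
  define seg where "seg e = closed_segment (fst e) (snd e)" for e :: "plane \<times> plane"
  have K: "K = (\<Union>e\<in>E. seg e)" by (auto simp: K_def seg_def case_prod_unfold)
  have "\<exists>n c. n \<noteq> 0 \<and> seg e \<subseteq> {x. inner n x = c}" if "e \<in> E" for e
  proof -
    have "fst e \<noteq> snd e" using ne that by auto
    thus ?thesis unfolding seg_def by (rule segment_in_line) blast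
  qed
  then obtain n c where n: "\<And>e. e \<in> E \<Longrightarrow> n e \<noteq> 0"
    and c: "\<And>e. e \<in> E \<Longrightarrow> seg e \<subseteq> {x. inner (n e) x = c e}"
    by metis
  define line where "line e = {x. inner (n e) x = c e}" for e
  define B where "B = (\<Union>e\<in>E. \<Union>e'\<in>{e'\<in>E. \<not> seg e' \<subseteq> line e}. seg e' \<inter> line e)"
  show ?thesis
  proof
    show "finite B"
      unfolding B_def seg_def line_def using fin
      by (intro finite_UN_I finite_segment_Int_hyperplane) auto
  next
    fix x assume x: "x \<in> K - B"
    then obtain e where e: "e \<in> E" "x \<in> seg e" by (auto simp: K)
    hence xl: "x \<in> line e" using c[OF e(1)] by (auto simp: line_def)
    define C where "C = (\<Union>e'\<in>{e'\<in>E. \<not> seg e' \<subseteq> line e}. seg e')"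
    have "closed C" using fin by (auto simp: C_def seg_def)
    moreover have "x \<notin> C" using x e(1) xl unfolding B_def C_def by blast
    ultimately obtain r where r: "r > 0" "ball x r \<subseteq> - C"
      using open_contains_ball[of "- C"] by (metis ComplI open_Compl)
    have "K \<inter> ball x r \<subseteq> line e" using r by (auto simp: K C_def)
    hence "K \<inter> ball x r \<subseteq> {y. inner (n e) (y - x) = 0}"
      using xl by (auto simp: line_def inner_diff_right)
    thus "\<exists>r>0. \<exists>n. n \<noteq> 0 \<and> K \<inter> ball x r \<subseteq> {y. inner n (y - x) = 0}"
      using r n[OF e(1)] by blast
  qed
qed

text \<open>
  Both open half balls are connected and avoid the frontier of \<open>T\<close>, so each lies inside \<open>T\<close> or
  outside. They cannot both lie outside, because \<open>T\<close> has interior points arbitrarily close to \<open>x\<close>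
  and these do not all fit into the line between the half balls.
\<close>

lemma half_ball_in_regular_closed_set:
  fixes T :: "'a::euclidean_space set"
  assumes T: "closure (interior T) = T" and x: "x \<in> T" and n: "n \<noteq> 0" and r: "r > 0"
    and fr: "frontier T \<inter> ball x r \<subseteq> {y. inner n (y - x) = 0}"
  shows "ball x r \<inter> {y. inner n (y - x) > 0} \<subseteq> interior T \<or>
         ball x r \<inter> {y. inner n (y - x) < 0} \<subseteq> interior T"
proof -
  define U where "U = interior T \<inter> ball x r"
  have half: "H \<subseteq> interior T"
    if H: "convex H" "H \<subseteq> ball x r" "H \<inter> {y. inner n (y - x) = 0} = {}" and y: "y \<in> H" "y \<in> U" for H y
  proof -
    have "H \<inter> frontier T = {}" using H fr by blast
    moreover have "y \<in> H \<inter> T" using y interior_subset by (auto simp: U_def)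
    ultimately have "H \<subseteq> T"
      using connected_Int_frontier[OF convex_connected[OF H(1)], of T] by blast
    thus ?thesis using \<open>H \<inter> frontier T = {}\<close> closure_subset[of T] by (auto simp: frontier_def)
  qed
  have hyper: "{y. inner n (y - x) = 0} = {y. inner n y = inner n x}"
    "{y. inner n (y - x) > 0} = {y. inner n y > inner n x}"
    "{y. inner n (y - x) < 0} = {y. inner n y < inner n x}"
    by (auto simp: inner_diff_right)
  have "x \<in> closure (interior T)" using x T by simp
  hence "U \<noteq> {}" unfolding U_def
    using r open_Int_closure_eq_empty[of "ball x r" "interior T"] centre_in_ball[of x r] by blast
  moreover have "open U" by (simp add: U_def open_Int)
  moreover have "interior {y. inner n (y - x) = 0} = {}"
    unfolding hyper by (rule interior_hyperplane[OF n])
  ultimately have "\<not> U \<subseteq> {y. inner n (y - x) = 0}"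
    using interior_maximal by blast
  then obtain y where y: "y \<in> U" "inner n (y - x) \<noteq> 0" by blast
  have conv: "convex (ball x r \<inter> {y. inner n (y - x) > 0})" "convex (ball x r \<inter> {y. inner n (y - x) < 0})"
    unfolding hyper by (auto intro!: convex_Int convex_halfspace_gt convex_halfspace_lt)
  show ?thesis
  proof (cases "inner n (y - x) > 0")
    case True
    hence "ball x r \<inter> {y. inner n (y - x) > 0} \<subseteq> interior T"
      using y by (intro half[OF conv(1), of y]) (auto simp: U_def)
    thus ?thesis by simp
  next
    case False
    hence "ball x r \<inter> {y. inner n (y - x) < 0} \<subseteq> interior T"
      using y by (intro half[OF conv(2), of y]) (auto simp: U_def)
    thus ?thesis by simp
  qed
qed

text \<open>
  An interior point of one set that lay in the other would be a limit of interior points of the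
  other, against the disjointness of the interiors.
\<close>

lemma disjoint_regular_closed_sets_meet:
  assumes S: "closure (interior S) = S" and S': "closure (interior S') = S'"
    and disj: "interior S \<inter> interior S' = {}"
  shows "S \<inter> S' \<subseteq> frontier S \<inter> frontier S'"
proof -
  have "interior S \<inter> S' = {}" "S \<inter> interior S' = {}"
    using open_Int_closure_eq_empty[of "interior S" "interior S'"]
      open_Int_closure_eq_empty[of "interior S'" "interior S"] disj S S' by auto
  thus ?thesis using closure_subset by (auto simp: frontier_def)
qed

text \<open>
  At all but finitely many common points both frontiers are locally contained in one line, so
  each polygon contains one of the two half balls. The interiors are disjoint, so the half balls
  are different ones; together they are dense in the ball, which the closed union therefore contains.
\<close>

lemma polygons_meet_outside_interior_finite:
  assumes S: "polygon S E" and S': "polygon S' E'" and disj: "interior S \<inter> interior S' = {}"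
  shows "finite (S \<inter> S' - interior (S \<union> S'))"
proof -
  define K where "K = (\<Union>(a, b) \<in> E \<union> E'. closed_segment a b)"
  have fr: "frontier S \<subseteq> K" "frontier S' \<subseteq> K"
    using S S' by (auto simp: polygon_def K_def)
  have reg: "closure (interior S) = S" "closure (interior S') = S'"
    using S S' by (auto simp: polygon_def)
  obtain B where B: "finite B"
    and loc: "\<And>x. x \<in> K - B \<Longrightarrow> \<exists>r>0. \<exists>n. n \<noteq> 0 \<and> K \<inter> ball x r \<subseteq> {y. inner n (y - x) = 0}"
    unfolding K_def by (rule segments_locally_in_line[of "E \<union> E'"]) (use S S' in \<open>auto simp: polygon_def\<close>)
  have "x \<in> interior (S \<union> S')" if x: "x \<in> S \<inter> S'" and xB: "x \<notin> B" for x
  proof -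
    have "x \<in> K" using disjoint_regular_closed_sets_meet[OF reg disj] x fr by blast
    then obtain r n where r: "r > 0" and n: "n \<noteq> 0" and K: "K \<inter> ball x r \<subseteq> {y. inner n (y - x) = 0}"
      using loc xB by blast
    let ?P = "ball x r \<inter> {y. inner n (y - x) > 0}" and ?M = "ball x r \<inter> {y. inner n (y - x) < 0}"
    have "x + (r / (2 * norm n)) *\<^sub>R n \<in> ?P" "x - (r / (2 * norm n)) *\<^sub>R n \<in> ?M"
      using r n by (auto simp: dist_norm)
    hence ne: "?P \<noteq> {}" "?M \<noteq> {}" by blast+
    have "?P \<subseteq> interior S \<or> ?M \<subseteq> interior S"
      by (rule half_ball_in_regular_closed_set) (use reg x n r K fr in auto)
    moreover have "?P \<subseteq> interior S' \<or> ?M \<subseteq> interior S'"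
      by (rule half_ball_in_regular_closed_set) (use reg x n r K fr in auto)
    ultimately have cover: "?P \<union> ?M \<subseteq> S \<union> S'"
      using ne disj interior_subset[of S] interior_subset[of S'] by blast
    have "ball x r - (S \<union> S') \<subseteq> {y. inner n (y - x) = 0}"
    proof
      fix y assume "y \<in> ball x r - (S \<union> S')"
      hence "\<not> 0 < inner n (y - x)" "\<not> inner n (y - x) < 0" using cover by blast+
      thus "y \<in> {y. inner n (y - x) = 0}" by simp
    qed
    hence "ball x r - (S \<union> S') \<subseteq> {y. inner n y = inner n x}"
      by (simp add: inner_diff_right)
    moreover have "open (ball x r - (S \<union> S'))"
      using S S' by (intro open_Diff closed_Un) (auto simp: polygon_def compact_imp_closed)
    ultimately have "ball x r - (S \<union> S') = {}"
      using interior_maximal interior_hyperplane[OF n, of "inner n x"] by blast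
    thus ?thesis using r by (auto simp: mem_interior)
  qed
  thus ?thesis by (intro finite_subset[OF _ B]) auto
qed

lemma polygons_overlap_null:
  assumes S: "polygon S E" and S': "polygon S' E'" and disj: "interior S \<inter> interior S' = {}"
  shows "AE x in lborel. \<not> (x \<in> S \<and> x \<in> S')"
proof (rule AE_I')
  have "frontier S \<in> null_sets (completion lborel)"
    using negligible_polygon_frontier[OF S] by (simp add: negligible_iff_null_sets)
  thus "frontier S \<in> null_sets lborel"
    by (subst (asm) null_sets_completion_iff) auto
  show "{x \<in> space lborel. \<not> \<not> (x \<in> S \<and> x \<in> S')} \<subseteq> frontier S"
    using disjoint_regular_closed_sets_meet[of S S'] S S' disj by (auto simp: polygon_def)
qed

lemma set_integral_finite_UN_AE_disjoint:
  fixes f :: "_ \<Rightarrow> _ :: {banach, second_countable_topology}"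
  assumes "finite I"
    and disj: "\<And>i j. i \<in> I \<Longrightarrow> j \<in> I \<Longrightarrow> i \<noteq> j \<Longrightarrow> AE x in M. \<not> (x \<in> A i \<and> x \<in> A j)"
    and meas: "\<And>i. i \<in> I \<Longrightarrow> A i \<in> sets M"
    and int: "\<And>i. i \<in> I \<Longrightarrow> set_integrable M (A i) f"
  shows "(LINT x:(\<Union>i\<in>I. A i)|M. f x) = (\<Sum>i\<in>I. LINT x:A i|M. f x)"
  using assms
proof (induction I rule: finite_induct)
  case empty
  show ?case by (simp add: set_lebesgue_integral_def)
next
  case (insert i I)
  have "AE x in M. \<forall>j\<in>I. \<not> (x \<in> A i \<and> x \<in> A j)"
    using insert by (subst AE_finite_all) auto
  hence ae: "AE x in M. \<not> (x \<in> A i \<and> x \<in> (\<Union>j\<in>I. A j))" by eventually_elim auto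
  have "(LINT x:(\<Union>j\<in>insert i I. A j)|M. f x) = (LINT x:A i \<union> (\<Union>j\<in>I. A j)|M. f x)" by simp
  also have "\<dots> = (LINT x:A i|M. f x) + (LINT x:(\<Union>j\<in>I. A j)|M. f x)"
    using insert.prems insert.hyps
    by (intro set_integral_Un_AE ae set_integrable_UN sets.finite_UN) auto
  finally show ?case using insert by simp
qed

section \<open>Polynomials\<close>

lemma continuous_on_compact_set_integrable:
  fixes f :: "'a::euclidean_space \<Rightarrow> 'b::{banach, second_countable_topology}"
  assumes "compact S" "continuous_on S f"
  shows "set_integrable lborel S f"
  using borel_integrable_compact[OF assms] by (simp add: set_integrable_def)

lemma poly_space_polynomial:
  assumes "p \<in> poly_space k"
  shows "real_polynomial_function p"
proof -
  obtain a :: "nat \<Rightarrow> nat \<Rightarrow> real" where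
    p: "p = (\<lambda>x. \<Sum>(i, j) \<in> {(i, j). i + j \<le> k}. a i j * fst x ^ i * snd x ^ j)"
    using assms by (auto simp: poly_space_def)
  have "{p. fst p + snd p \<le> k} \<subseteq> {..k} \<times> {..k}" by auto
  hence fin: "finite {p. fst p + snd p \<le> k}" by (rule finite_subset) simp
  show ?thesis unfolding p case_prod_unfold
    by (intro real_polynomial_function_sum fin real_polynomial_function.intros(4) real_polynomial_function_power
        real_polynomial_function.intros(2) real_polynomial_function.intros(1) bounded_linear_fst bounded_linear_snd)
qed

text \<open>
  On the line from a point of \<open>U\<close> to \<open>x\<close> the function is a univariate polynomial with infinitely many
  zeros.
\<close>

lemma polynomial_zero_on_open:
  fixes p :: "'a::real_normed_vector \<Rightarrow> real"
  assumes p: "real_polynomial_function p" and U: "open U" "U \<noteq> {}" and 0: "\<And>x. x \<in> U \<Longrightarrow> p x = 0"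
  shows "p x = 0"
proof -
  obtain z where z: "z \<in> U" using U by blast
  define line where "line t = z + t *\<^sub>R (x - z)" for t :: real
  have "polynomial_function line"
    unfolding line_def by (intro polynomial_function_add polynomial_function_const
      polynomial_function_bounded_linear bounded_linear_scaleR_left)
  hence "real_polynomial_function (p \<circ> line)"
    using p by (rule real_polynomial_function_compose)
  then obtain a n where a: "p \<circ> line = (\<lambda>t. \<Sum>i\<le>n. a i * t ^ i)"
    using real_polynomial_function_iff_sum by blast
  have "open (line -` U)"
    unfolding line_def using U by (intro open_vimage continuous_intros) auto
  moreover have "0 \<in> line -` U" using z by (simp add: line_def)
  ultimately have "infinite (line -` U)"
    using finite_imp_not_open[of "line -` U"] by blast
  moreover have "line -` U \<subseteq> {t. (\<Sum>i\<le>n. a i * t ^ i) = 0}"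
  proof
    fix t assume "t \<in> line -` U"
    hence "(p \<circ> line) t = 0" using 0 by simp
    thus "t \<in> {t. (\<Sum>i\<le>n. a i * t ^ i) = 0}" unfolding a by simp
  qed
  ultimately have "infinite {t. (\<Sum>i\<le>n. a i * t ^ i) = 0}"
    using finite_subset by blast
  hence "\<forall>i\<le>n. a i = 0" using polyfun_finite_roots[of a n] by blast
  hence "(p \<circ> line) 1 = 0" by (simp add: a)
  thus ?thesis by (simp add: line_def)
qed

lemma continuous_square_integral_zero:
  fixes f :: "'a::euclidean_space \<Rightarrow> real"
  assumes S: "compact S" and f: "continuous_on S f"
    and 0: "(LINT x:S|lborel. f x * f x) = 0" and x: "x \<in> interior S"
  shows "f x = 0"
proof (rule ccontr)
  assume nz: "f x \<noteq> 0"
  define U where "U = {y \<in> interior S. f y \<noteq> 0}"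
  have "continuous_on (interior S) f" using f interior_subset by (rule continuous_on_subset)
  hence U: "open U"
    unfolding U_def by (intro continuous_open_preimage[where T = "- {0}", simplified vimage_def Int_def, simplified]) auto
  have int: "set_integrable lborel S (\<lambda>x. f x * f x)"
    using S f by (intro continuous_on_compact_set_integrable continuous_intros)
  have "AE x in lborel. indicator S x *\<^sub>R (f x * f x) = 0"
    using 0 int unfolding set_lebesgue_integral_def set_integrable_def
    by (subst (asm) integral_nonneg_eq_0_iff_AE) (auto simp: indicator_def)
  hence "AE x in lborel. x \<notin> U"
    by eventually_elim (use interior_subset in \<open>auto simp: U_def indicator_def\<close>)
  hence "U \<in> null_sets lborel" using U by (subst AE_iff_null_sets) auto
  hence "negligible U" by (simp add: negligible_iff_null_sets null_sets_completionI)
  moreover have "x \<in> U" using x nz by (simp add: U_def)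
  ultimately show False using open_not_negligible[OF U] by blast
qed

text \<open>
  The gradient is defined by a definite description; this shows that it denotes.
\<close>

lemma polynomial_gderiv:
  fixes p :: "plane \<Rightarrow> real"
  assumes "real_polynomial_function p"
  shows "GDERIV p x :> grad p x"
proof -
  obtain D where D: "(p has_derivative D) (at x)"
    using differentiable_at_real_polynomial_function[OF assms, of x UNIV] unfolding differentiable_def by blast
  have "linear D" using D by (rule has_derivative_linear)
  hence "D = (\<lambda>h. inner h (adjoint D 1))" by (simp add: adjoint_works)
  hence ex: "GDERIV p x :> adjoint D 1" using D by (simp add: gderiv_def)
  show ?thesis unfolding grad_def
  proof (rule theI[where P = "\<lambda>E. GDERIV p x :> E", OF ex])
    fix E assume "GDERIV p x :> E"
    hence "(\<lambda>h. inner h E) = (\<lambda>h. inner h (adjoint D 1))"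
      using ex unfolding gderiv_def by (rule has_derivative_unique)
    thus "E = adjoint D 1" using vector_eq_ldot[of E "adjoint D 1"] by (metis)
  qed
qed

section \<open>Integrals of sums and along edges\<close>

lemma set_integral_finite_sum:
  fixes f :: "'i \<Rightarrow> 'a \<Rightarrow> 'b::{banach, second_countable_topology}"
  assumes "\<And>i. i \<in> I \<Longrightarrow> set_integrable M A (f i)"
  shows "set_integrable M A (\<lambda>x. \<Sum>i\<in>I. f i x)"
    and "(LINT x:A|M. \<Sum>i\<in>I. f i x) = (\<Sum>i\<in>I. LINT x:A|M. f i x)"
  using assms unfolding set_integrable_def set_lebesgue_integral_def scaleR_sum_right
  by (simp_all add: Bochner_Integration.integral_sum)

lemma edge_integrable_scale:
  "edge_integrable E f \<Longrightarrow> edge_integrable E (\<lambda>x. a * f x)"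
  unfolding edge_integrable_def by (auto intro!: set_integrable_mult_right)

lemma edge_integral_scale:
  "edge_integral E (\<lambda>x. a * f x) = a * edge_integral E f"
  by (simp add: edge_integral_def sum_distrib_left case_prod_unfold mult_ac)

lemma edge_integral_sum:
  assumes f: "\<And>i. i \<in> I \<Longrightarrow> edge_integrable E (f i)"
  shows "edge_integrable E (\<lambda>x. \<Sum>i\<in>I. f i x)"
    and "edge_integral E (\<lambda>x. \<Sum>i\<in>I. f i x) = (\<Sum>i\<in>I. edge_integral E (f i))"
proof -
  have int: "set_integrable lborel {0..1} (\<lambda>s. f i (linepath (fst e) (snd e) s))"
    if "i \<in> I" "e \<in> E" for i e
    using f[OF that(1)] that(2) by (auto simp: edge_integrable_def)
  show "edge_integrable E (\<lambda>x. \<Sum>i\<in>I. f i x)"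
    unfolding edge_integrable_def case_prod_unfold by (intro ballI set_integral_finite_sum(1) int)
  have "(LINT s:{0..1}|lborel. \<Sum>i\<in>I. f i (linepath (fst e) (snd e) s)) =
      (\<Sum>i\<in>I. LINT s:{0..1}|lborel. f i (linepath (fst e) (snd e) s))" if "e \<in> E" for e
    using int[OF _ that] by (rule set_integral_finite_sum(2))
  hence "edge_integral E (\<lambda>x. \<Sum>i\<in>I. f i x) =
      (\<Sum>e\<in>E. \<Sum>i\<in>I. dist (fst e) (snd e) * (LINT s:{0..1}|lborel. f i (linepath (fst e) (snd e) s)))"
    by (simp add: edge_integral_def case_prod_unfold sum_distrib_left)
  also have "\<dots> = (\<Sum>i\<in>I. edge_integral E (f i))"
    unfolding edge_integral_def case_prod_unfold by (rule sum.swap)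
  finally show "edge_integral E (\<lambda>x. \<Sum>i\<in>I. f i x) = (\<Sum>i\<in>I. edge_integral E (f i))" .
qed

lemma edge_integrable_indicator:
  assumes K: "closed K" and g: "edge_integrable E g"
  shows "edge_integrable E (\<lambda>x. indicator K x * g x)"
  unfolding edge_integrable_def
proof clarify
  fix a b assume "(a, b) \<in> E"
  hence "integrable lborel (\<lambda>s. indicator {0..1} s *\<^sub>R g (linepath a b s))"
    using g by (auto simp: edge_integrable_def set_integrable_def)
  moreover have "closed (linepath a b -` K)"
    using K by (intro closed_vimage) (auto simp: linepath_def intro!: continuous_intros)
  ultimately have "integrable lborel (\<lambda>s. indicator (linepath a b -` K) s *\<^sub>R (indicator {0..1} s *\<^sub>R g (linepath a b s)))"
    by (intro integrable_mult_indicator[of "linepath a b -` K" lborel]) simp_all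
  thus "set_integrable lborel {0..1} (\<lambda>s. indicator K (linepath a b s) * g (linepath a b s))"
    unfolding set_integrable_def indicator_vimage by (simp add: mult.left_commute)
qed

text \<open>
  Edges are nondegenerate, so a finite set of points has a finite, hence null, set of parameters on
  each of them.
\<close>

lemma edge_integral_cong_finite:
  assumes ne: "\<forall>(a, b) \<in> E. a \<noteq> b" and B: "finite B"
    and eq: "\<And>x. x \<in> (\<Union>(a, b) \<in> E. closed_segment a b) - B \<Longrightarrow> f x = g x"
    and f: "edge_integrable E f" and g: "edge_integrable E g"
  shows "edge_integral E f = edge_integral E g"
  unfolding edge_integral_def
proof (intro sum.cong refl, clarify)
  fix a b assume e: "(a, b) \<in> E"
  have "inj (linepath a b)"
  proof (rule injI)
    fix s t assume "linepath a b s = linepath a b t"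
    hence "(s - t) *\<^sub>R (b - a) = 0" by (simp add: linepath_def algebra_simps)
    thus "s = t" using ne e by auto
  qed
  hence "finite (linepath a b -` B)" using B by (simp add: finite_vimageI)
  hence "AE s in lborel. s \<notin> linepath a b -` B"
    by (intro AE_not_in finite_imp_null_set_lborel)
  hence "AE s in lborel. indicator {0..1} s *\<^sub>R f (linepath a b s) = indicator {0..1} s *\<^sub>R g (linepath a b s)"
  proof eventually_elim
    case (elim s)
    have "linepath a b s \<in> closed_segment a b" if "s \<in> {0..1}"
      using that by (auto simp: linepath_image_01[symmetric])
    thus ?case using elim eq[of "linepath a b s"] e by (auto simp: indicator_def)
  qed
  moreover have int: "integrable lborel (\<lambda>s. indicator {0..1} s *\<^sub>R h (linepath a b s))"
    if "edge_integrable E h" for h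
    using that e by (auto simp: edge_integrable_def set_integrable_def)
  ultimately have "(LINT s:{0..1}|lborel. f (linepath a b s)) = (LINT s:{0..1}|lborel. g (linepath a b s))"
    unfolding set_lebesgue_integral_def
    by (intro integral_cong_AE borel_measurable_integrable int f g)
  thus "dist a b * (LINT s:{0..1}|lborel. f (linepath a b s)) = dist a b * (LINT s:{0..1}|lborel. g (linepath a b s))"
    by simp
qed

section \<open>The mass and projection matrices\<close>

lemma num_subcells_pos: "num_subcells c > 0"
proof -
  have "(0 + 1) * (0 + 2) div 2 \<le> num_subcells c"
    unfolding num_subcells_def by (intro div_le_mono mult_le_mono) auto
  thus ?thesis by simp
qed

lemma cell_compact: "valid_cell c \<Longrightarrow> compact (cell_domain c)"
  by (simp add: valid_cell_def polygon_def)

lemma subcell_compact: "valid_cell c \<Longrightarrow> m < num_subcells c \<Longrightarrow> compact (subcell c m)"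
  by (auto simp: valid_cell_def subdivision_def polygon_def)

lemma subcell_polygon:
  assumes "valid_cell c" "m < num_subcells c"
  obtains E where "polygon (subcell c m) E"
  using assms by (metis valid_cell_def subdivision_def)

lemma subcell_interiors_disjoint:
  "valid_cell c \<Longrightarrow> m < num_subcells c \<Longrightarrow> p < num_subcells c \<Longrightarrow> m \<noteq> p \<Longrightarrow>
    interior (subcell c m) \<inter> interior (subcell c p) = {}"
  by (simp add: valid_cell_def subdivision_def)

lemma area_pos: "valid_cell c \<Longrightarrow> m < num_subcells c \<Longrightarrow> area (subcell c m) > 0"
  by (auto simp: valid_cell_def subdivision_def)

lemma basis_polynomial:
  "valid_cell c \<Longrightarrow> m < num_subcells c \<Longrightarrow> real_polynomial_function (basis c m)"
  by (auto simp: valid_cell_def poly_basis_def intro: poly_space_polynomial)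

lemma dg_solution_polynomial:
  assumes "valid_cell c"
  shows "real_polynomial_function (dg_solution c U)"
  unfolding dg_solution_def
  by (intro real_polynomial_function_sum real_polynomial_function.intros(2,4) basis_polynomial assms) auto

lemma polynomial_continuous_on:
  fixes p :: "'a::euclidean_space \<Rightarrow> real"
  assumes "real_polynomial_function p"
  shows "continuous_on S p"
  using assms by (simp add: real_polynomial_function_eq continuous_on_polymonial_function)

lemma polynomial_set_integrable:
  fixes p :: "'a::euclidean_space \<Rightarrow> real"
  assumes "real_polynomial_function p" "compact S"
  shows "set_integrable lborel S p"
  using assms by (intro continuous_on_compact_set_integrable polynomial_continuous_on)

lemma constant_one_in_basis:
  assumes "valid_cell c"
  obtains a where "a \<in> carrier_vec (num_subcells c)" "dg_solution c a = (\<lambda>x. 1)"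
proof -
  define k where "k = poly_degree c"
  have fin: "finite {p :: nat \<times> nat. fst p + snd p \<le> k}"
    by (rule finite_subset[of _ "{..k} \<times> {..k}"]) auto
  have "(\<lambda>x :: plane. 1 :: real) =
      (\<lambda>x. \<Sum>(i, j) \<in> {(i, j). i + j \<le> k}. (if (i, j) = (0, 0) then 1 else 0) * fst x ^ i * snd x ^ j)"
  proof
    fix x :: plane
    have "(\<Sum>(i, j) \<in> {(i, j). i + j \<le> k}. (if (i, j) = (0, 0) then 1 else 0) * fst x ^ i * snd x ^ j) =
        (\<Sum>p \<in> {p. fst p + snd p \<le> k}. if p = (0, 0) then 1 else 0)"
      unfolding case_prod_unfold
    proof (rule sum.cong)
      fix p :: "nat \<times> nat"
      show "(if (fst p, snd p) = (0, 0) then 1 else 0) * fst x ^ fst p * snd x ^ snd p =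
          (if p = (0, 0) then 1 else 0)" by (cases "p = (0, 0)") auto
    qed simp
    also have "\<dots> = 1" by (simp add: sum.delta[OF fin])
    finally show "1 = (\<Sum>(i, j) \<in> {(i, j). i + j \<le> k}.
        (if (i, j) = (0, 0) then 1 else 0) * fst x ^ i * snd x ^ j)" by simp
  qed
  hence "(\<lambda>x :: plane. 1 :: real) \<in> poly_space k"
    unfolding poly_space_def by (intro CollectI exI[of _ "\<lambda>i j. if (i, j) = (0, 0) then 1 else 0"])
  hence "\<exists>a. a \<in> carrier_vec (num_subcells c) \<and> (\<lambda>x. 1) = (\<lambda>x. \<Sum>m<num_subcells c. a $ m * basis c m x)"
    using assms by (auto simp: valid_cell_def poly_basis_def k_def)
  thus ?thesis using that by (auto simp: dg_solution_def[abs_def])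
qed

lemma dg_solution_inj:
  assumes c: "valid_cell c" and v: "v \<in> carrier_vec (num_subcells c)"
    and 0: "dg_solution c v = (\<lambda>x. 0)"
  shows "v = 0\<^sub>v (num_subcells c)"
proof -
  let ?rep = "\<lambda>a. a \<in> carrier_vec (num_subcells c) \<and>
    (\<lambda>x. 0) = (\<lambda>x. \<Sum>m<num_subcells c. a $ m * basis c m x)"
  have "(\<lambda>x. 0) \<in> poly_space (poly_degree c)"
    unfolding poly_space_def by (auto intro!: exI[of _ "\<lambda>_ _. 0"])
  hence "\<exists>!a. ?rep a"
    using c by (auto simp: valid_cell_def poly_basis_def)
  moreover have "?rep v" using v 0 by (simp add: dg_solution_def[abs_def])
  moreover have "?rep (0\<^sub>v (num_subcells c))" by simp
  ultimately show ?thesis by blast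
qed

lemma mass_matrix_dim [simp]: "mass_matrix c \<in> carrier_mat (num_subcells c) (num_subcells c)"
  by (simp add: mass_matrix_def)

lemma mass_matrix_mult:
  assumes c: "valid_cell c" and v: "v \<in> carrier_vec (num_subcells c)" and m: "m < num_subcells c"
  shows "(mass_matrix c *\<^sub>v v) $ m = (LINT x:cell_domain c|lborel. basis c m x * dg_solution c v x)"
proof -
  have int: "set_integrable lborel (cell_domain c) (\<lambda>x. v $ p * (basis c m x * basis c p x))"
    if "p \<in> {..<num_subcells c}" for p
    using that m by (intro polynomial_set_integrable cell_compact c basis_polynomial
      real_polynomial_function.intros(2,4)) auto
  have "(LINT x:cell_domain c|lborel. basis c m x * dg_solution c v x) =
      (LINT x:cell_domain c|lborel. \<Sum>p<num_subcells c. v $ p * (basis c m x * basis c p x))"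
    by (simp add: dg_solution_def sum_distrib_left mult.left_commute)
  also have "\<dots> = (\<Sum>p<num_subcells c. LINT x:cell_domain c|lborel. v $ p * (basis c m x * basis c p x))"
    by (rule set_integral_finite_sum(2)) (rule int)
  also have "\<dots> = (\<Sum>p<num_subcells c. v $ p * (LINT x:cell_domain c|lborel. basis c m x * basis c p x))"
    by simp
  also have "\<dots> = (mass_matrix c *\<^sub>v v) $ m"
    using v m by (simp add: mass_matrix_def scalar_prod_def lessThan_atLeast0 mult.commute)
  finally show ?thesis by simp
qed

text \<open>
  The mass matrix is the Gram matrix of the basis for the integral over the cell. This turns
  both its injectivity and the test with the constant 1 into statements about integrals.
\<close>

lemma mass_matrix_form:
  assumes c: "valid_cell c" and v: "v \<in> carrier_vec (num_subcells c)"
  shows "scalar_prod a (mass_matrix c *\<^sub>v v) =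
    (LINT x:cell_domain c|lborel. dg_solution c a x * dg_solution c v x)"
proof -
  have int: "set_integrable lborel (cell_domain c) (\<lambda>x. a $ m * (basis c m x * dg_solution c v x))"
    if "m \<in> {..<num_subcells c}" for m
    using that by (intro polynomial_set_integrable cell_compact c basis_polynomial dg_solution_polynomial
      real_polynomial_function.intros(2,4)) auto
  have "(LINT x:cell_domain c|lborel. dg_solution c a x * dg_solution c v x) =
      (LINT x:cell_domain c|lborel. \<Sum>m<num_subcells c. a $ m * (basis c m x * dg_solution c v x))"
    by (simp add: dg_solution_def[of c a] sum_distrib_right mult.assoc)
  also have "\<dots> = (\<Sum>m<num_subcells c. LINT x:cell_domain c|lborel. a $ m * (basis c m x * dg_solution c v x))"
    by (rule set_integral_finite_sum(2)) (rule int)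
  also have "\<dots> = (\<Sum>m<num_subcells c. a $ m * (LINT x:cell_domain c|lborel. basis c m x * dg_solution c v x))"
    by simp
  also have "\<dots> = scalar_prod a (mass_matrix c *\<^sub>v v)"
    using carrier_matD(1)[OF mass_matrix_dim[of c]] unfolding scalar_prod_def dim_mult_mat_vec
    by (intro sum.cong) (auto simp: mass_matrix_mult[OF c v] simp del: index_mult_mat_vec)
  finally show ?thesis by simp
qed

lemma mass_matrix_injective:
  assumes c: "valid_cell c" and v: "v \<in> carrier_vec (num_subcells c)"
    and 0: "mass_matrix c *\<^sub>v v = 0\<^sub>v (num_subcells c)"
  shows "v = 0\<^sub>v (num_subcells c)"
proof -
  have poly: "polygon (cell_domain c) (edges c)" using c by (simp add: valid_cell_def)
  have "(LINT x:cell_domain c|lborel. dg_solution c v x * dg_solution c v x) = 0"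
    using mass_matrix_form[OF c v, of v] v by (simp add: 0)
  hence z: "dg_solution c v x = 0" if "x \<in> interior (cell_domain c)" for x
    using that c by (intro continuous_square_integral_zero[of "cell_domain c" "dg_solution c v"]
      cell_compact polynomial_continuous_on dg_solution_polynomial)
  have "subcell c 0 \<noteq> {}"
    using area_pos[OF c num_subcells_pos] by (auto simp: area_def)
  moreover have "subcell c 0 \<subseteq> cell_domain c"
    using c num_subcells_pos[of c] unfolding valid_cell_def subdivision_def by blast
  ultimately have "interior (cell_domain c) \<noteq> {}" using poly by (auto simp: polygon_def)
  hence "dg_solution c v = (\<lambda>x. 0)"
    using z polynomial_zero_on_open[OF dg_solution_polynomial[OF c, of v] open_interior] by blast
  thus ?thesis by (rule dg_solution_inj[OF c v])
qed

lemma mass_matrix_inverse: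
  assumes c: "valid_cell c"
  shows "matrix_inverse (mass_matrix c) \<in> carrier_mat (num_subcells c) (num_subcells c)"
    and "mass_matrix c * matrix_inverse (mass_matrix c) = 1\<^sub>m (num_subcells c)"
    and "matrix_inverse (mass_matrix c) * mass_matrix c = 1\<^sub>m (num_subcells c)"
  by (rule matrix_inverse_injective[OF mass_matrix_dim mass_matrix_injective[OF c]]; assumption)+

lemma projection_matrix_mult:
  assumes c: "valid_cell c" and v: "v \<in> carrier_vec (num_subcells c)"
  shows "projection_matrix c *\<^sub>v v = submeans c (dg_solution c v)"
proof (rule eq_vecI)
  fix m assume "m < dim_vec (submeans c (dg_solution c v))"
  hence m: "m < num_subcells c" by (simp add: submeans_def)
  have int: "set_integrable lborel (subcell c m) (\<lambda>x. v $ p * basis c p x)"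
    if "p \<in> {..<num_subcells c}" for p
    using that m by (intro polynomial_set_integrable subcell_compact c basis_polynomial
      real_polynomial_function.intros(2,4)) auto
  have "(LINT x:subcell c m|lborel. dg_solution c v x) =
      (\<Sum>p<num_subcells c. LINT x:subcell c m|lborel. v $ p * basis c p x)"
    unfolding dg_solution_def by (rule set_integral_finite_sum(2)) (rule int)
  thus "(projection_matrix c *\<^sub>v v) $ m = submeans c (dg_solution c v) $ m"
    using v m by (simp add: projection_matrix_def submeans_def scalar_prod_def lessThan_atLeast0
      sum_divide_distrib mult.commute)
qed (simp add: projection_matrix_def submeans_def)

section \<open>Conservation\<close>

lemma integral_subcells:
  fixes f :: "plane \<Rightarrow> real"
  assumes c: "valid_cell c" and f: "\<And>m. m < num_subcells c \<Longrightarrow> set_integrable lborel (subcell c m) f"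
  shows "(\<Sum>m<num_subcells c. LINT x:subcell c m|lborel. f x) = (LINT x:cell_domain c|lborel. f x)"
proof -
  have "AE x in lborel. \<not> (x \<in> subcell c m \<and> x \<in> subcell c p)"
    if mp: "m < num_subcells c" "p < num_subcells c" "m \<noteq> p" for m p
  proof -
    obtain E where E: "polygon (subcell c m) E" by (rule subcell_polygon[OF c mp(1)])
    obtain E' where E': "polygon (subcell c p) E'" by (rule subcell_polygon[OF c mp(2)])
    show ?thesis by (rule polygons_overlap_null[OF E E' subcell_interiors_disjoint[OF c mp]])
  qed
  hence "(LINT x:(\<Union>m<num_subcells c. subcell c m)|lborel. f x) =
      (\<Sum>m<num_subcells c. LINT x:subcell c m|lborel. f x)"
    using f subcell_compact[OF c]
    by (intro set_integral_finite_UN_AE_disjoint) (auto intro: borel_compact)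
  thus ?thesis using c by (simp add: valid_cell_def subdivision_def)
qed

text \<open>
  A point of the boundary of the cell lies in some subcell, and on the frontier of that subcell since
  it is not interior to the cell. Apart from finitely many points it lies in only one subcell, since
  points common to two subcells are, up to finitely many, interior to their union.
\<close>

lemma boundary_partition:
  assumes c: "valid_cell c" and g: "edge_integrable (edges c) g"
  shows "(\<Sum>m<num_subcells c. edge_integral (edges c)
      (\<lambda>x. indicator (frontier (subcell c m) \<inter> frontier (cell_domain c)) x * g x)) =
    edge_integral (edges c) g"
proof -
  let ?N = "num_subcells c" and ?\<omega> = "cell_domain c"
  let ?K = "\<lambda>m. frontier (subcell c m) \<inter> frontier ?\<omega>"
  (* the points of the boundary of the cell that two subcells share *)
  define B where "B = (\<Union>m<?N. \<Union>p\<in>{..<?N} - {m}. subcell c m \<inter> subcell c p - interior ?\<omega>)"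
  have union: "(\<Union>m<?N. subcell c m) = ?\<omega>"
    using c by (simp add: valid_cell_def subdivision_def)
  have poly: "polygon ?\<omega> (edges c)" using c by (simp add: valid_cell_def)
  have meet: "finite (subcell c m \<inter> subcell c p - interior ?\<omega>)" if mp: "m < ?N" "p < ?N" "m \<noteq> p" for m p
  proof -
    obtain E where E: "polygon (subcell c m) E" by (rule subcell_polygon[OF c mp(1)])
    obtain E' where E': "polygon (subcell c p) E'" by (rule subcell_polygon[OF c mp(2)])
    have fin: "finite (subcell c m \<inter> subcell c p - interior (subcell c m \<union> subcell c p))"
      by (rule polygons_meet_outside_interior_finite[OF E E' subcell_interiors_disjoint[OF c mp]])
    have "interior (subcell c m \<union> subcell c p) \<subseteq> interior ?\<omega>"
      using union mp by (intro interior_mono) blast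
    thus ?thesis by (intro finite_subset[OF _ fin]) blast
  qed
  have B: "finite B" unfolding B_def by (intro finite_UN_I meet) auto
  have one: "(\<Sum>m<?N. indicator (?K m) x) = (1 :: real)" if x: "x \<in> frontier ?\<omega> - B" for x
  proof -
    have "closed ?\<omega>" by (rule compact_imp_closed[OF cell_compact[OF c]])
    hence x\<omega>: "x \<in> ?\<omega>" "x \<notin> interior ?\<omega>" using x by (auto simp: frontier_def)
    then obtain m where m: "m < ?N" "x \<in> subcell c m" using union by blast
    have only: "p = m" if "p < ?N" "x \<in> subcell c p" for p
      using x x\<omega> m that by (auto simp: B_def)
    have "interior (subcell c m) \<subseteq> interior ?\<omega>" using union m by (intro interior_mono) blast
    hence "x \<in> ?K m" using x m x\<omega> closure_subset by (auto simp: frontier_def)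
    moreover have "x \<notin> ?K p" if "p < ?N" "p \<noteq> m" for p
      using only[OF that(1)] that(2) frontier_subset_compact[OF subcell_compact[OF c that(1)]] by blast
    ultimately have "(\<Sum>p<?N. indicator (?K p) x) = (\<Sum>p<?N. if p = m then 1 else 0 :: real)"
      by (intro sum.cong) (auto simp: indicator_def)
    thus ?thesis using m by simp
  qed
  have int: "edge_integrable (edges c) (\<lambda>x. indicator (?K m) x * g x)" for m
    by (intro edge_integrable_indicator g closed_Int frontier_closed)
  have "(\<Sum>m<?N. edge_integral (edges c) (\<lambda>x. indicator (?K m) x * g x)) =
      edge_integral (edges c) (\<lambda>x. \<Sum>m<?N. indicator (?K m) x * g x)"
    by (rule edge_integral_sum(2)[symmetric]) (rule int)
  also have "\<dots> = edge_integral (edges c) g"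
  proof (rule edge_integral_cong_finite[OF _ B])
    fix x assume "x \<in> (\<Union>(a, b) \<in> edges c. closed_segment a b) - B"
    hence "x \<in> frontier ?\<omega> - B" using poly by (simp add: polygon_def)
    thus "(\<Sum>m<?N. indicator (?K m) x * g x) = g x"
      using one by (simp add: sum_distrib_right[symmetric])
  next
    show "edge_integrable (edges c) (\<lambda>x. \<Sum>m<?N. indicator (?K m) x * g x)"
      by (rule edge_integral_sum(1)) (rule int)
  qed (use poly g in \<open>auto simp: polygon_def\<close>)
  finally show ?thesis .
qed

text \<open>
  This is the weak form tested with the constant 1: the volume term drops out because the gradients
  of the basis functions, weighted by the moments of 1, add up to 0.
\<close>

lemma residual_sum:
  assumes c: "valid_cell c" and def: "residual_defined c F H w U"
    and a: "a \<in> carrier_vec (num_subcells c)" "dg_solution c a = (\<lambda>x. 1)"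
  shows "edge_integrable (edges c) (normal_flux c H w U)"
    and "scalar_prod a (residual c F H w U) = - edge_integral (edges c) (normal_flux c H w U)"
proof -
  let ?N = "num_subcells c" and ?g = "normal_flux c H w U"
  have one: "(\<Sum>m<?N. a $ m * basis c m x) = 1" for x
    using fun_cong[OF a(2), of x] by (simp add: dg_solution_def)
  have bdry: "edge_integrable (edges c) (\<lambda>x. a $ m * (basis c m x * ?g x))" if "m \<in> {..<?N}" for m
    using def that by (intro edge_integrable_scale) (auto simp: residual_defined_def)
  have g: "(\<lambda>x. \<Sum>m<?N. a $ m * (basis c m x * ?g x)) = ?g"
    using one by (simp add: mult.assoc[symmetric] sum_distrib_right[symmetric])
  have "edge_integrable (edges c) (\<lambda>x. \<Sum>m<?N. a $ m * (basis c m x * ?g x))"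
    by (rule edge_integral_sum(1)) (rule bdry)
  thus "edge_integrable (edges c) ?g" unfolding g .
  have "edge_integral (edges c) (\<lambda>x. \<Sum>m<?N. a $ m * (basis c m x * ?g x)) =
      (\<Sum>m<?N. edge_integral (edges c) (\<lambda>x. a $ m * (basis c m x * ?g x)))"
    by (rule edge_integral_sum(2)) (rule bdry)
  hence bsum: "(\<Sum>m<?N. a $ m * edge_integral (edges c) (\<lambda>x. basis c m x * ?g x)) = edge_integral (edges c) ?g"
    unfolding g by (simp add: edge_integral_scale)
  have grad0: "(\<Sum>m<?N. a $ m *\<^sub>R grad (basis c m) x) = 0" for x
  proof -
    have "((\<lambda>y. \<Sum>m<?N. a $ m * basis c m y) has_derivative
        (\<lambda>h. \<Sum>m<?N. a $ m * inner h (grad (basis c m) x))) (at x)"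
      using polynomial_gderiv[OF basis_polynomial[OF c]]
      by (intro has_derivative_sum has_derivative_mult_right) (auto simp: gderiv_def)
    moreover have "((\<lambda>y. \<Sum>m<?N. a $ m * basis c m y) has_derivative (\<lambda>h. 0)) (at x)"
      by (simp add: one)
    ultimately have "(\<lambda>h. \<Sum>m<?N. a $ m * inner h (grad (basis c m) x)) = (\<lambda>h. 0)"
      by (rule has_derivative_unique)
    hence "inner h (\<Sum>m<?N. a $ m *\<^sub>R grad (basis c m) x) = 0" for h
      by (auto simp: inner_sum_right dest: fun_cong)
    thus ?thesis by (metis inner_eq_zero_iff)
  qed
  have vol: "set_integrable lborel (cell_domain c)
      (\<lambda>x. a $ m * inner (F (dg_solution c U x)) (grad (basis c m) x))" if "m \<in> {..<?N}" for m
    using def that by (intro set_integrable_mult_right) (auto simp: residual_defined_def)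
  have "(\<Sum>m<?N. a $ m * (LINT x:cell_domain c|lborel. inner (F (dg_solution c U x)) (grad (basis c m) x))) =
      (\<Sum>m<?N. LINT x:cell_domain c|lborel. a $ m * inner (F (dg_solution c U x)) (grad (basis c m) x))"
    by simp
  also have "\<dots> = (LINT x:cell_domain c|lborel. \<Sum>m<?N. a $ m * inner (F (dg_solution c U x)) (grad (basis c m) x))"
    by (rule set_integral_finite_sum(2)[symmetric]) (rule vol)
  also have "(\<lambda>x. \<Sum>m<?N. a $ m * inner (F (dg_solution c U x)) (grad (basis c m) x)) = (\<lambda>x. 0)"
  proof
    fix x
    have "(\<Sum>m<?N. a $ m * inner (F (dg_solution c U x)) (grad (basis c m) x)) =
        inner (F (dg_solution c U x)) (\<Sum>m<?N. a $ m *\<^sub>R grad (basis c m) x)"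
      by (simp add: inner_sum_right)
    thus "(\<Sum>m<?N. a $ m * inner (F (dg_solution c U x)) (grad (basis c m) x)) = 0"
      by (simp add: grad0)
  qed
  finally have vsum: "(\<Sum>m<?N. a $ m *
      (LINT x:cell_domain c|lborel. inner (F (dg_solution c U x)) (grad (basis c m) x))) = 0"
    by simp
  show "scalar_prod a (residual c F H w U) = - edge_integral (edges c) ?g"
    using vsum bsum
    by (simp add: residual_def scalar_prod_def lessThan_atLeast0 right_diff_distrib sum_subtractf)
qed

lemma residual_dim [simp]: "residual c F H w U \<in> carrier_vec (num_subcells c)"
  by (simp add: residual_def)

lemma boundary_flux_dim [simp]: "boundary_flux c H w U \<in> carrier_vec (num_subcells c)"
  by (simp add: boundary_flux_def)

lemma projection_matrix_dim [simp]: "projection_matrix c \<in> carrier_mat (num_subcells c) (num_subcells c)"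
  by (simp add: projection_matrix_def)

lemma volume_matrix_dim [simp]: "volume_matrix c \<in> carrier_mat (num_subcells c) (num_subcells c)"
  by (simp add: volume_matrix_def)

lemma volume_matrix_mult:
  assumes "v \<in> carrier_vec (num_subcells c)" and m: "m < num_subcells c"
  shows "(volume_matrix c *\<^sub>v v) $ m = area (subcell c m) * v $ m"
proof -
  have "(volume_matrix c *\<^sub>v v) $ m =
      (\<Sum>p = 0..<num_subcells c. (if m = p then area (subcell c p) else 0) * v $ p)"
    using assms by (simp add: volume_matrix_def mat_diag_def scalar_prod_def)
  also have "\<dots> = (\<Sum>p = 0..<num_subcells c. if p = m then area (subcell c m) * v $ m else 0)"
    by (intro sum.cong) auto
  finally show ?thesis using m by simp
qed

lemma volume_matrix_injective:
  assumes c: "valid_cell c" and v: "v \<in> carrier_vec (num_subcells c)"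
    and 0: "volume_matrix c *\<^sub>v v = 0\<^sub>v (num_subcells c)"
  shows "v = 0\<^sub>v (num_subcells c)"
proof (rule eq_vecI)
  fix m assume "m < dim_vec (0\<^sub>v (num_subcells c) :: real vec)"
  hence m: "m < num_subcells c" by simp
  hence "area (subcell c m) * v $ m = 0" using volume_matrix_mult[OF v m] by (simp add: 0)
  thus "v $ m = 0\<^sub>v (num_subcells c) $ m" using area_pos[OF c m] m by simp
qed (use v in simp)

lemma volume_matrix_inverse:
  assumes c: "valid_cell c"
  shows "matrix_inverse (volume_matrix c) \<in> carrier_mat (num_subcells c) (num_subcells c)"
    and "volume_matrix c * matrix_inverse (volume_matrix c) = 1\<^sub>m (num_subcells c)"
    and "matrix_inverse (volume_matrix c) * volume_matrix c = 1\<^sub>m (num_subcells c)"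
  by (rule matrix_inverse_injective[OF volume_matrix_dim volume_matrix_injective[OF c]]; assumption)+

text \<open>
  The compatibility condition for the equation \<open>L y = r\<close>, and the only place where the
  conservation property of the DG scheme enters.
\<close>

lemma flux_balance:
  assumes c: "valid_cell c" and def: "residual_defined c F H w U"
  defines "V \<equiv> matrix_inverse (mass_matrix c) *\<^sub>v residual c F H w U"
  shows "(\<Sum>m<num_subcells c. (volume_matrix c * projection_matrix c *\<^sub>v V + boundary_flux c H w U) $ m) = 0"
proof -
  let ?N = "num_subcells c"
  obtain a where a: "a \<in> carrier_vec ?N" "dg_solution c a = (\<lambda>x. 1)"
    by (rule constant_one_in_basis[OF c])
  note inv = mass_matrix_inverse[OF c]
  have V: "V \<in> carrier_vec ?N" unfolding V_def by (rule mult_mat_vec_carrier[OF inv(1) residual_dim])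
  have MV: "mass_matrix c *\<^sub>v V = residual c F H w U"
    unfolding V_def assoc_mult_mat_vec[OF mass_matrix_dim inv(1) residual_dim, symmetric] inv(2)
    by (rule one_mult_mat_vec[OF residual_dim])
  have PV: "projection_matrix c *\<^sub>v V \<in> carrier_vec ?N" by (rule mult_mat_vec_carrier[OF projection_matrix_dim V])
  have QV: "(volume_matrix c * projection_matrix c *\<^sub>v V) $ m = (LINT x:subcell c m|lborel. dg_solution c V x)"
    if m: "m < ?N" for m
  proof -
    have "(volume_matrix c * projection_matrix c *\<^sub>v V) $ m = area (subcell c m) * (projection_matrix c *\<^sub>v V) $ m"
      unfolding assoc_mult_mat_vec[OF volume_matrix_dim projection_matrix_dim V] by (rule volume_matrix_mult[OF PV m])
    thus ?thesis
      unfolding projection_matrix_mult[OF c V] using area_pos[OF c m] m by (simp add: submeans_def)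
  qed
  have "(\<Sum>m<?N. (volume_matrix c * projection_matrix c *\<^sub>v V) $ m) =
      (\<Sum>m<?N. LINT x:subcell c m|lborel. dg_solution c V x)"
    using QV by (intro sum.cong) auto
  also have "\<dots> = (LINT x:cell_domain c|lborel. dg_solution c V x)"
    using c by (intro integral_subcells polynomial_set_integrable dg_solution_polynomial subcell_compact)
  also have "\<dots> = scalar_prod a (mass_matrix c *\<^sub>v V)"
    using mass_matrix_form[OF c V, of a] by (simp add: a(2))
  also have "\<dots> = - edge_integral (edges c) (normal_flux c H w U)"
    unfolding MV by (rule residual_sum(2)[OF c def a])
  also have "edge_integral (edges c) (normal_flux c H w U) = (\<Sum>m<?N. boundary_flux c H w U $ m)"
    using boundary_partition[OF c residual_sum(1)[OF c def a]] by (simp add: boundary_flux_def)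
  finally have "(\<Sum>m<?N. (volume_matrix c * projection_matrix c *\<^sub>v V) $ m + boundary_flux c H w U $ m) = 0"
    by (simp add: sum.distrib)
  moreover have "(\<Sum>m<?N. (volume_matrix c * projection_matrix c *\<^sub>v V + boundary_flux c H w U) $ m) =
      (\<Sum>m<?N. (volume_matrix c * projection_matrix c *\<^sub>v V) $ m + boundary_flux c H w U $ m)"
    by (intro sum.cong refl index_add_vec(1)) (simp add: boundary_flux_def)
  ultimately show ?thesis by (rule trans[rotated])
qed

section \<open>The subcell scheme\<close>

lemma mult_mat_vec_uminus:
  fixes A :: "'a :: ring mat"
  assumes A: "A \<in> carrier_mat m n" and v: "v \<in> carrier_vec n"
  shows "A *\<^sub>v (- v) = - (A *\<^sub>v v)"
  using A v by (intro eq_vecI) auto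

lemma laplacian_inverse_solves:
  assumes c: "valid_cell c" and con: "Digraph_Component.connected (face_graph c)"
    and r: "r \<in> carrier_vec (num_subcells c)" "(\<Sum>m<num_subcells c. r $ m) = 0"
  shows "kernel_orthogonal_inverse (laplacian_matrix c) \<in> carrier_mat (num_subcells c) (num_subcells c)"
    and "laplacian_matrix c *\<^sub>v (kernel_orthogonal_inverse (laplacian_matrix c) *\<^sub>v r) = r"
proof -
  have f: "interior_faces c" using c by (simp add: valid_cell_def)
  note solves = kernel_orthogonal_inverse_solves[OF num_subcells_pos laplacian_matrix_dim
      laplacian_matrix_kernel[OF f con] laplacian_matrix_range[OF f]]
  show "kernel_orthogonal_inverse (laplacian_matrix c) \<in> carrier_mat (num_subcells c) (num_subcells c)"
    by (rule solves(1))
  show "laplacian_matrix c *\<^sub>v (kernel_orthogonal_inverse (laplacian_matrix c) *\<^sub>v r) = r"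
    by (rule solves(2)[OF _ _ r])
qed

lemma reconstructed_flux_divergence:
  assumes c: "valid_cell c" and con: "Digraph_Component.connected (face_graph c)"
    and def: "residual_defined c F H w U"
  defines "V \<equiv> matrix_inverse (mass_matrix c) *\<^sub>v residual c F H w U"
  shows "adjacency_matrix c *\<^sub>v reconstructed_flux c F H w U =
    - (volume_matrix c * projection_matrix c *\<^sub>v V + boundary_flux c H w U)"
proof -
  let ?N = "num_subcells c" and ?A = "adjacency_matrix c" and ?L = "laplacian_matrix c"
  let ?Linv = "kernel_orthogonal_inverse ?L"
  define r where "r = volume_matrix c * projection_matrix c *\<^sub>v V + boundary_flux c H w U"
  have V: "V \<in> carrier_vec ?N"
    unfolding V_def by (rule mult_mat_vec_carrier[OF mass_matrix_inverse(1)[OF c] residual_dim])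
  have r: "r \<in> carrier_vec ?N"
    unfolding r_def by (intro add_carrier_vec boundary_flux_dim
      mult_mat_vec_carrier[OF mult_carrier_mat[OF volume_matrix_dim projection_matrix_dim] V])
  have s: "(\<Sum>m<?N. r $ m) = 0"
    unfolding r_def V_def by (rule flux_balance[OF c def])
  note Linv = laplacian_inverse_solves[OF c con r s]
  have y: "?Linv *\<^sub>v r \<in> carrier_vec ?N" by (rule mult_mat_vec_carrier[OF Linv(1) r])
  have At: "transpose_mat ?A \<in> carrier_mat (num_faces c) ?N" by simp
  have g: "transpose_mat ?A *\<^sub>v (?Linv *\<^sub>v r) \<in> carrier_vec (num_faces c)"
    by (rule mult_mat_vec_carrier[OF At y])
  have "?A *\<^sub>v (- (transpose_mat ?A *\<^sub>v (?Linv *\<^sub>v r))) = - (?A *\<^sub>v (transpose_mat ?A *\<^sub>v (?Linv *\<^sub>v r)))"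
    by (rule mult_mat_vec_uminus[OF adjacency_matrix_dim(1) g])
  also have "?A *\<^sub>v (transpose_mat ?A *\<^sub>v (?Linv *\<^sub>v r)) = ?A * transpose_mat ?A *\<^sub>v (?Linv *\<^sub>v r)"
    by (rule assoc_mult_mat_vec[OF adjacency_matrix_dim(1) At y, symmetric])
  also have "\<dots> = r" using Linv(2) by (simp only: laplacian_matrix_def[symmetric])
  finally show ?thesis unfolding reconstructed_flux_def Let_def r_def V_def .
qed

lemma subcell_scheme_rhs:
  assumes c: "valid_cell c" and con: "Digraph_Component.connected (face_graph c)"
    and def: "residual_defined c F H w U"
  defines "V \<equiv> matrix_inverse (mass_matrix c) *\<^sub>v residual c F H w U"
  shows "- (matrix_inverse (volume_matrix c) *\<^sub>v
      (adjacency_matrix c *\<^sub>v reconstructed_flux c F H w U + boundary_flux c H w U)) =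
    projection_matrix c *\<^sub>v V"
proof -
  let ?N = "num_subcells c" and ?D = "volume_matrix c" and ?b = "boundary_flux c H w U"
  have V: "V \<in> carrier_vec ?N"
    unfolding V_def by (rule mult_mat_vec_carrier[OF mass_matrix_inverse(1)[OF c] residual_dim])
  define p where "p = projection_matrix c *\<^sub>v V"
  have p: "p \<in> carrier_vec ?N" unfolding p_def by (rule mult_mat_vec_carrier[OF projection_matrix_dim V])
  have Dp: "?D *\<^sub>v p \<in> carrier_vec ?N" by (rule mult_mat_vec_carrier[OF volume_matrix_dim p])
  note inv = volume_matrix_inverse[OF c]
  have "adjacency_matrix c *\<^sub>v reconstructed_flux c F H w U = - (?D *\<^sub>v p + ?b)"
    unfolding reconstructed_flux_divergence[OF c con def] p_def V_def
      assoc_mult_mat_vec[OF volume_matrix_dim projection_matrix_dim V[unfolded V_def]] ..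
  also have "\<dots> + ?b = - (?D *\<^sub>v p)"
  proof -
    have "- (x + y) + y = - x" if "x \<in> carrier_vec n" "y \<in> carrier_vec n" for x y :: "real vec" and n
      using that by (intro eq_vecI) auto
    thus ?thesis using Dp boundary_flux_dim .
  qed
  finally have "- (matrix_inverse ?D *\<^sub>v
      (adjacency_matrix c *\<^sub>v reconstructed_flux c F H w U + ?b)) = - (matrix_inverse ?D *\<^sub>v (- (?D *\<^sub>v p)))"
    by simp
  also have "\<dots> = matrix_inverse ?D *\<^sub>v (?D *\<^sub>v p)"
    unfolding mult_mat_vec_uminus[OF inv(1) Dp] by (rule uminus_uminus_vec)
  also have "\<dots> = p"
    unfolding assoc_mult_mat_vec[OF inv(1) volume_matrix_dim p, symmetric] inv(3)
    by (rule one_mult_mat_vec[OF p])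
  finally show ?thesis by (simp add: p_def)
qed

text \<open>
  Used in both directions of the equivalence, with the projection matrix and with its inverse. The
  relation between \<open>U\<close> and \<open>W\<close> is known on \<open>T\<close> only, which suffices for derivatives within \<open>T\<close>.
\<close>

lemma has_time_derivative_mult_mat_vec:
  assumes X: "X \<in> carrier_mat n n" and V: "V \<in> carrier_vec n" and t: "t \<in> T"
    and U: "\<And>s. s \<in> T \<Longrightarrow> U s \<in> carrier_vec n"
    and W: "\<And>s. s \<in> T \<Longrightarrow> W s = X *\<^sub>v U s"
    and der: "has_time_derivative U V (at t within T)"
  shows "has_time_derivative W (X *\<^sub>v V) (at t within T)"
  unfolding has_time_derivative_def
proof (intro allI impI)
  fix m assume "m < dim_vec (X *\<^sub>v V)"
  hence m: "m < n" using X by simp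
  have XU: "(X *\<^sub>v v) $ m = (\<Sum>p<n. X $$ (m, p) * v $ p)" if "v \<in> carrier_vec n" for v
    using X m that by (simp add: scalar_prod_def lessThan_atLeast0)
  have "((\<lambda>s. \<Sum>p<n. X $$ (m, p) * U s $ p) has_real_derivative (X *\<^sub>v V) $ m) (at t within T)"
    unfolding XU[OF V] using der V
    by (intro DERIV_sum DERIV_cmult) (auto simp: has_time_derivative_def)
  thus "((\<lambda>s. W s $ m) has_real_derivative (X *\<^sub>v V) $ m) (at t within T)"
    by (rule has_field_derivative_transform_within[where d = 1]) (use t W XU[OF U] in auto)
qed

theorem theorem2p1:
  fixes c :: subdivided_cell
    and F :: "real \<Rightarrow> plane" and H :: numerical_flux
    and w :: "real \<Rightarrow> plane \<Rightarrow> real"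
    and T :: "real set" and U Ubar :: "real \<Rightarrow> real vec"
  assumes "valid_cell c"
    and "invertible_mat (projection_matrix c)"
    and "Digraph_Component.connected (face_graph c)"
    and "\<And>t. t \<in> T \<Longrightarrow> U t \<in> carrier_vec (num_subcells c)"
    and "\<And>t. t \<in> T \<Longrightarrow> residual_defined c F H (w t) (U t)"
    and "\<And>t. t \<in> T \<Longrightarrow> Ubar t = submeans c (dg_solution c (U t))"
  shows "(\<forall>t\<in>T. Ubar t = projection_matrix c *\<^sub>v U t) \<and>
    ((\<forall>t\<in>T. has_time_derivative U
        (matrix_inverse (mass_matrix c) *\<^sub>v residual c F H (w t) (U t)) (at t within T)) \<longleftrightarrow>
     (\<forall>t\<in>T. has_time_derivative Ubar
        (- (matrix_inverse (volume_matrix c) *\<^sub>v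
            (adjacency_matrix c *\<^sub>v reconstructed_flux c F H (w t) (U t)
             + boundary_flux c H (w t) (U t)))) (at t within T)))"
proof -
  let ?N = "num_subcells c" and ?P = "projection_matrix c"
  define V where "V t = matrix_inverse (mass_matrix c) *\<^sub>v residual c F H (w t) (U t)" for t
  have V: "V t \<in> carrier_vec ?N" for t
    unfolding V_def by (rule mult_mat_vec_carrier[OF mass_matrix_inverse(1)[OF assms(1)] residual_dim])
  have PU: "Ubar t = ?P *\<^sub>v U t" if "t \<in> T" for t
    using projection_matrix_mult[OF assms(1) assms(4)[OF that]] assms(6)[OF that] by simp
  obtain R where "inverts_mat ?P R" "inverts_mat R ?P"
    using assms(2) by (auto simp: invertible_mat_def)
  hence PR: "?P * R = 1\<^sub>m ?N" and RP: "R * ?P = 1\<^sub>m (dim_row R)"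
    using carrier_matD(1)[OF projection_matrix_dim[of c]] by (auto simp: inverts_mat_def)
  have "dim_col R = ?N" using arg_cong[OF PR, of dim_col] by simp
  moreover have "dim_row R = ?N"
    using arg_cong[OF RP, of dim_col] carrier_matD(2)[OF projection_matrix_dim[of c]] by simp
  ultimately have R: "R \<in> carrier_mat ?N ?N" by auto
  have RPv: "R *\<^sub>v (?P *\<^sub>v v) = v" if "v \<in> carrier_vec ?N" for v
    unfolding assoc_mult_mat_vec[OF R projection_matrix_dim that, symmetric] RP \<open>dim_row R = ?N\<close>
    by (rule one_mult_mat_vec[OF that])
  have Ubar: "Ubar t \<in> carrier_vec ?N" if "t \<in> T" for t
    using assms(6)[OF that] by (simp add: submeans_def)
  have equiv: "has_time_derivative U (V t) (at t within T) \<longleftrightarrow>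
      has_time_derivative Ubar (?P *\<^sub>v V t) (at t within T)" if t: "t \<in> T" for t
  proof
    assume der: "has_time_derivative U (V t) (at t within T)"
    show "has_time_derivative Ubar (?P *\<^sub>v V t) (at t within T)"
      by (rule has_time_derivative_mult_mat_vec[OF projection_matrix_dim V t _ _ der])
         (erule assms(4), erule PU)
  next
    assume der: "has_time_derivative Ubar (?P *\<^sub>v V t) (at t within T)"
    have U: "U s = R *\<^sub>v Ubar s" if "s \<in> T" for s
      unfolding PU[OF that] by (rule RPv[OF assms(4)[OF that], symmetric])
    have "has_time_derivative U (R *\<^sub>v (?P *\<^sub>v V t)) (at t within T)"
      by (rule has_time_derivative_mult_mat_vec[OF R mult_mat_vec_carrier[OF projection_matrix_dim V] t _ _ der])
         (erule Ubar, erule U)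
    thus "has_time_derivative U (V t) (at t within T)" unfolding RPv[OF V] .
  qed
  have rhs: "- (matrix_inverse (volume_matrix c) *\<^sub>v
      (adjacency_matrix c *\<^sub>v reconstructed_flux c F H (w t) (U t) + boundary_flux c H (w t) (U t))) =
      ?P *\<^sub>v V t" if "t \<in> T" for t
    unfolding V_def by (rule subcell_scheme_rhs[OF assms(1,3) assms(5)[OF that]])
  show ?thesis
  proof (intro conjI)
    show "\<forall>t\<in>T. Ubar t = ?P *\<^sub>v U t" using PU by blast
  qed (unfold V_def[symmetric], intro ball_cong refl, simp only: rhs equiv)
qed

end
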